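(* Let $\mathbf{k}$ be a field of characteristic $0$ and $B$ a $\mathbb{Z}$-graded normal affine $\mathbf{k}$-domain. If $B$ is saturated in codimension $1$ then $\mathrm{NR}(B) = \emptyset$ or $\mathrm{NR}(B) = \mathbb{N} \setminus \{0\}$.
   Context: Rings are commutative, associative and unital; "domain" means integral domain; normal means integrally closed in the field of fractions; an affine $\mathbf{k}$-domain is a domain that is a finitely generated $\mathbf{k}$-algebra. $\mathbb{N}$ contains $0$. Let $B=\bigoplus_{i\in\mathbb{Z}}B_i$ be a $\mathbb{Z}$-graded domain. For $d\ge1$, $B^{(d)}=\bigoplus_{i\in d\mathbb{Z}}B_i$. Define $e(B)=\gcd\{n\in\mathbb{Z}:B_n\neq0\}\in\mathbb{N}$. Let $Z$ be the set of height $1$ homogeneous prime ideals of $B$; define $\bar e(B)=\mathrm{lcm}\{e(B/\mathfrak{p}):\mathfrak{p}\in Z\}$ if $Z\neq\emptyset$, and $\bar e(B)=e(B)$ if $Z=\emptyset$. Here $\gcd(S)$ is the nonnegative generator of the ideal of $\mathbb{Z}$ generated by $S$, and for nonempty $S\subseteq\mathbb{Z}$, $\mathrm{lcm}(S)$ is the nonnegative generator of $\bigcap_{a\in S}a\mathbb{Z}$. $B$ is saturated in codimension $1$ if $\bar e(B)=e(B)$ (equivalently, $e(B/\mathfrak{p})=e(B)$ for all $\mathfrak{p}\in Z$). A derivation $D:R\to R$ is locally nilpotent if for each $b\in R$ there is $n>0$ with $D^n(b)=0$. A ring is rigid if its only locally nilpotent derivation is $0$. $\mathrm{NR}(B)=\{d\in\mathbb{N}\setminus\{0\}:B^{(d)}\text{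 is non-rigid}\}$. *)

theory Defs
  imports
    "HOL-Computational_Algebra.Computational_Algebra"
    "HOL-Library.Extended_Nat"
    "HOL-Library.Set_Algebras"
begin

section \<open>Subrings, ideals, height\<close>

definition is_subring :: "'a::comm_ring_1 set \<Rightarrow> bool" where
  "is_subring A \<longleftrightarrow>
     1 \<in> A \<and> (\<forall>x\<in>A. \<forall>y\<in>A. x - y \<in> A) \<and> (\<forall>x\<in>A. \<forall>y\<in>A. x * y \<in> A)"

definition is_ideal :: "'a::comm_ring_1 set \<Rightarrow> bool" where
  "is_ideal I \<longleftrightarrow>
     0 \<in> I \<and> (\<forall>x\<in>I. \<forall>y\<in>I. x + y \<in> I) \<and> (\<forall>r. \<forall>x\<in>I. r * x \<in> I)"

definition is_prime_ideal :: "'a::comm_ring_1 set \<Rightarrow> bool" where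
  "is_prime_ideal P \<longleftrightarrow>
     is_ideal P \<and> P \<noteq> UNIV \<and> (\<forall>x y. x * y \<in> P \<longrightarrow> x \<in> P \<or> y \<in> P)"

text \<open>The supremum of the lengths \<open>n\<close> of chains \<open>c 0 \<subset> \<dots> \<subset> c n = P\<close> of prime ideals.\<close>

definition ideal_height :: "'a::comm_ring_1 set \<Rightarrow> enat" where
  "ideal_height P =
     Sup {enat n | n. \<exists>c :: nat \<Rightarrow> 'a set.
       (\<forall>i\<le>n. is_prime_ideal (c i)) \<and> (\<forall>i<n. c i \<subset> c (Suc i)) \<and> c n = P}"


section \<open>Normal domains and finitely generated algebras\<close>

definition integral_over_base :: "'a::idom fract \<Rightarrow> bool" where
  "integral_over_base q \<longleftrightarrow>
     (\<exists>p :: 'a poly. lead_coeff p = 1 \<and> poly (map_poly to_fract p) q = 0)"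

definition normal_domain :: "'a::idom itself \<Rightarrow> bool" where
  "normal_domain (_ :: 'a itself) \<longleftrightarrow>
     (\<forall>q :: 'a fract. integral_over_base q \<longrightarrow> q \<in> range to_fract)"

text \<open>A \<open>k\<close>-algebra structure on a ring is given by its structure homomorphism.\<close>

definition algebra_map :: "('k::field \<Rightarrow> 'a::comm_ring_1) \<Rightarrow> bool" where
  "algebra_map \<iota> \<longleftrightarrow>
     \<iota> 1 = 1 \<and> (\<forall>x y. \<iota> (x + y) = \<iota> x + \<iota> y) \<and> (\<forall>x y. \<iota> (x * y) = \<iota> x * \<iota> y)"

definition affine_algebra :: "('k::field \<Rightarrow> 'a::comm_ring_1) \<Rightarrow> bool" where
  "affine_algebra \<iota> \<longleftrightarrow>
     algebra_map \<iota> \<and> (\<exists>S. finite S \<and> is_subring hull (range \<iota> \<union> S) = UNIV)"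


section \<open>Gradings by the integers\<close>

definition is_grading :: "(int \<Rightarrow> 'a::comm_ring_1 set) \<Rightarrow> bool" where
  "is_grading B \<longleftrightarrow>
     (\<forall>i. 0 \<in> B i \<and> (\<forall>x\<in>B i. \<forall>y\<in>B i. x - y \<in> B i)) \<and>
     (\<forall>i j. \<forall>x\<in>B i. \<forall>y\<in>B j. x * y \<in> B (i + j)) \<and>
     (\<forall>b. \<exists>!f. (\<forall>i. f i \<in> B i) \<and> finite {i. f i \<noteq> 0} \<and> b = (\<Sum>i | f i \<noteq> 0. f i))"

definition veronese :: "nat \<Rightarrow> (int \<Rightarrow> 'a::comm_ring_1 set) \<Rightarrow> 'a set" where
  "veronese d B =
     {(\<Sum>i\<in>I. f i) | I f. finite I \<and> (\<forall>i\<in>I. int d dvd i \<and> f i \<in> B i)}"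

definition homogeneous_ideal :: "(int \<Rightarrow> 'a::comm_ring_1 set) \<Rightarrow> 'a set \<Rightarrow> bool" where
  "homogeneous_ideal B I \<longleftrightarrow> (\<exists>H \<subseteq> (\<Union>i. B i). I = is_ideal hull H)"

text \<open>
  The invariant \<open>e\<close> of a family \<open>C\<close> of homogeneous components with zero element \<open>z\<close>.  The element
  \<open>z\<close> is a parameter because \<open>e\<close> is needed both for the ring itself and for its quotients, whose
  elements are cosets.
\<close>

definition grading_gcd :: "'c \<Rightarrow> (int \<Rightarrow> 'c set) \<Rightarrow> int" where
  "grading_gcd z C = Gcd {n. C n \<noteq> {z}}"

definition e_ring :: "(int \<Rightarrow> 'a::comm_ring_1 set) \<Rightarrow> int" where
  "e_ring B = grading_gcd 0 B"

text \<open>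
  The elements of \<open>B/P\<close> are the cosets \<open>b +o P\<close>, and \<open>(B/P)\<^sub>n\<close> is the image of
  \<open>B\<^sub>n\<close>.
\<close>

definition quotient_component ::
    "(int \<Rightarrow> 'a::comm_ring_1 set) \<Rightarrow> 'a set \<Rightarrow> int \<Rightarrow> 'a set set" where
  "quotient_component B P n = (\<lambda>b. b +o P) ` B n"

definition e_quotient :: "(int \<Rightarrow> 'a::comm_ring_1 set) \<Rightarrow> 'a set \<Rightarrow> int" where
  "e_quotient B P = grading_gcd (0 +o P) (quotient_component B P)"

definition height_one_homogeneous_primes ::
    "(int \<Rightarrow> 'a::comm_ring_1 set) \<Rightarrow> 'a set set" where
  "height_one_homogeneous_primes B =
     {P. is_prime_ideal P \<and> homogeneous_ideal B P \<and> ideal_height P = 1}"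

text \<open>
  \<open>Lcm\<close> and \<open>Gcd\<close> on \<open>int\<close> are the nonnegative generators of the intersection and of the sum of the
  principal ideals, also for infinite sets; in particular \<open>Lcm S = 0\<close> if \<open>S\<close> is infinite or
  contains \<open>0\<close>, and \<open>Gcd {} = Gcd {0} = 0\<close>.
\<close>

definition e_bar :: "(int \<Rightarrow> 'a::comm_ring_1 set) \<Rightarrow> int" where
  "e_bar B =
     (if height_one_homogeneous_primes B = {} then e_ring B
      else Lcm (e_quotient B ` height_one_homogeneous_primes B))"

definition saturated_in_codim_1 :: "(int \<Rightarrow> 'a::comm_ring_1 set) \<Rightarrow> bool" where
  "saturated_in_codim_1 B \<longleftrightarrow> e_bar B = e_ring B"


section \<open>Locally nilpotent derivations and rigidity\<close>

text \<open>
  A derivation of a subring \<open>A\<close> is represented by a function on the ambient type; its values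
  outside \<open>A\<close> are irrelevant.
\<close>

definition derivation_on :: "'a::comm_ring_1 set \<Rightarrow> ('a \<Rightarrow> 'a) \<Rightarrow> bool" where
  "derivation_on A D \<longleftrightarrow>
     (\<forall>x\<in>A. D x \<in> A) \<and>
     (\<forall>x\<in>A. \<forall>y\<in>A. D (x + y) = D x + D y) \<and>
     (\<forall>x\<in>A. \<forall>y\<in>A. D (x * y) = D x * y + x * D y)"

definition locally_nilpotent_on :: "'a::comm_ring_1 set \<Rightarrow> ('a \<Rightarrow> 'a) \<Rightarrow> bool" where
  "locally_nilpotent_on A D \<longleftrightarrow> (\<forall>b\<in>A. \<exists>n>0. (D ^^ n) b = 0)"

definition rigid :: "'a::comm_ring_1 set \<Rightarrow> bool" where
  "rigid A \<longleftrightarrow>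
     (\<forall>D. derivation_on A D \<and> locally_nilpotent_on A D \<longrightarrow> (\<forall>x\<in>A. D x = 0))"

definition NR :: "(int \<Rightarrow> 'a::comm_ring_1 set) \<Rightarrow> nat set" where
  "NR B = {d. d > 0 \<and> \<not> rigid (veronese d B)}"

end

theory Submission
  imports Defs
begin

text \<open>
  A nonzero locally nilpotent derivation \<open>D\<close> of \<open>B\<^sup>(\<^sup>d\<^sup>)\<close> may be taken homogeneous, of degree
  \<open>m\<close>: replace it by its top component. It extends uniquely to the field of fractions; on a
  homogeneous \<open>b\<close> the extension is \<open>D (b\<^sup>d) / (d b\<^sup>d\<^sup>-\<^sup>1)\<close>. Saturation in codimension 1
  makes this regular at all homogeneous primes of height 1, hence an element of \<open>B\<close> because \<open>B\<close> is
  normal and noetherian. The extension is locally nilpotent: applied to a homogeneous \<open>b\<close>, it lowers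
  the \<open>D\<close>-degree of \<open>b\<^sup>d\<close> by \<open>d\<close>.

  Conversely, let \<open>D\<close> be a homogeneous locally nilpotent derivation of \<open>B\<close> of degree \<open>m\<close>, with
  kernel \<open>K\<close> and a homogeneous \<open>t\<close> such that \<open>D t \<noteq> 0 = D (D t)\<close>. Inverting the nonzero homogeneous
  elements of \<open>K\<close> turns \<open>B\<close> into a polynomial ring in \<open>t\<close>, and \<open>t\<close> generates there a homogeneous
  prime, whose contraction \<open>P\<close> to \<open>B\<close> has height 1. The degrees of \<open>B/P\<close> are differences of degrees of
  \<open>K\<close>, so by saturation the degrees of \<open>K\<close> generate the same group as those of \<open>B\<close>. Hence for each \<open>d\<close>
  some nonzero homogeneous \<open>h \<in> K\<close> has degree \<open>- m\<close> modulo \<open>d\<close>, and \<open>h D\<close> restricts to \<open>B\<^sup>(\<^sup>d\<^sup>)\<close>.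
\<close>

section \<open>Noetherian rings\<close>

text \<open>Finite generation of all ideals, phrased by sequences: each sequence in \<open>R\<close>
  has a term in the ideal of \<open>R\<close> generated by the earlier ones. Both the basis theorem
  and the integrality argument use this form directly. It speaks of subrings so that generators can
  be adjoined one by one inside a fixed type.\<close>

definition noetherian_subring :: "'a::comm_ring_1 set \<Rightarrow> bool" where
  "noetherian_subring R \<longleftrightarrow> is_subring R \<and>
     (\<forall>a :: nat \<Rightarrow> 'a. range a \<subseteq> R \<longrightarrow>
        (\<exists>n c. (\<forall>i<n. c i \<in> R) \<and> a n = (\<Sum>i<n. c i * a i)))"

lemma subring_0: "is_subring R \<Longrightarrow> 0 \<in> R"
  unfolding is_subring_def by (metis diff_self)

lemma subring_1: "is_subring R \<Longrightarrow> 1 \<in> R"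
  unfolding is_subring_def by blast

lemma subring_diff: "is_subring R \<Longrightarrow> x \<in> R \<Longrightarrow> y \<in> R \<Longrightarrow> x - y \<in> R"
  unfolding is_subring_def by blast

lemma subring_mult: "is_subring R \<Longrightarrow> x \<in> R \<Longrightarrow> y \<in> R \<Longrightarrow> x * y \<in> R"
  unfolding is_subring_def by blast

lemma subring_add: "is_subring R \<Longrightarrow> x \<in> R \<Longrightarrow> y \<in> R \<Longrightarrow> x + y \<in> R"
  using subring_diff[of R x "0 - y"] subring_diff[of R 0 y] subring_0[of R] by simp

lemma subring_sum: "is_subring R \<Longrightarrow> (\<And>i. i \<in> I \<Longrightarrow> f i \<in> R) \<Longrightarrow> sum f I \<in> R"
  by (induction I rule: infinite_finite_induct) (auto intro: subring_0 subring_add)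

lemma subring_power: "is_subring R \<Longrightarrow> x \<in> R \<Longrightarrow> x ^ n \<in> R"
  by (induction n) (auto intro: subring_1 subring_mult)

lemma subring_of_nat: "is_subring R \<Longrightarrow> of_nat n \<in> R"
  by (induction n) (auto intro: subring_0 subring_1 subring_add)

section \<open>Polynomials over a subring and Hilbert's basis theorem\<close>

definition polys_over :: "'a::comm_ring_1 set \<Rightarrow> 'a poly set" where
  "polys_over R = {p. \<forall>i. coeff p i \<in> R}"

lemma is_subring_polys_over: "is_subring R \<Longrightarrow> is_subring (polys_over R)"
  by (subst is_subring_def)
    (auto simp: polys_over_def coeff_mult coeff_1 intro: subring_0 subring_1 subring_diff subring_mult subring_sum)

lemma pCons_in_polys_over: "c \<in> R \<Longrightarrow> p \<in> polys_over R \<Longrightarrow> pCons c p \<in> polys_over R"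
  by (auto simp: polys_over_def coeff_pCons split: nat.splits)

lemma const_in_polys_over: "is_subring R \<Longrightarrow> c \<in> R \<Longrightarrow> [:c:] \<in> polys_over R"
  by (auto simp: polys_over_def coeff_pCons intro: subring_0 split: nat.splits)

lemma monom_in_polys_over: "is_subring R \<Longrightarrow> c \<in> R \<Longrightarrow> monom c n \<in> polys_over R"
  by (auto simp: polys_over_def intro: subring_0)

definition adjoin :: "'a::comm_ring_1 set \<Rightarrow> 'a \<Rightarrow> 'a set" where
  "adjoin R x = (\<lambda>p. poly p x) ` polys_over R"

lemma is_subring_adjoin:
  assumes "is_subring R" shows "is_subring (adjoin R x)"
  unfolding is_subring_def
proof (intro conjI ballI)
  note P = is_subring_polys_over[OF assms]
  show "1 \<in> adjoin R x"
    unfolding adjoin_def by (rule image_eqI[where x = 1]) (auto intro: subring_1[OF P])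
  fix u v assume "u \<in> adjoin R x" "v \<in> adjoin R x"
  then obtain p q where "p \<in> polys_over R" "q \<in> polys_over R" "u = poly p x" "v = poly q x"
    unfolding adjoin_def by blast
  then have "u - v = poly (p - q) x \<and> p - q \<in> polys_over R" "u * v = poly (p * q) x \<and> p * q \<in> polys_over R"
    using subring_diff[OF P] subring_mult[OF P] by auto
  then show "u - v \<in> adjoin R x" "u * v \<in> adjoin R x"
    unfolding adjoin_def by blast+
qed

lemma subset_adjoin: "is_subring R \<Longrightarrow> R \<subseteq> adjoin R x"
  unfolding adjoin_def by (force intro: const_in_polys_over)

lemma in_adjoin: "is_subring R \<Longrightarrow> x \<in> adjoin R x"
  unfolding adjoin_def
  by (rule image_eqI[where x = "[:0, 1:]"])
    (auto intro!: pCons_in_polys_over subring_0 subring_1 subring_0[OF is_subring_polys_over])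

text \<open>For a sequence in \<open>R\<close>, the ideal of \<open>R\<close> generated by its first
  \<open>n\<close> terms; it is zero for \<open>n = 0\<close>.\<close>

definition span_below :: "'a::comm_ring_1 set \<Rightarrow> (nat \<Rightarrow> 'a) \<Rightarrow> nat \<Rightarrow> 'a set" where
  "span_below R a n = {(\<Sum>i<n. c i * a i) | c. \<forall>i<n. c i \<in> R}"

lemma span_below_add:
  assumes "is_subring R" "x \<in> span_below R a n" "y \<in> span_below R a n"
  shows "x + y \<in> span_below R a n"
proof -
  obtain c c' where "\<forall>i<n. c i \<in> R" "x = (\<Sum>i<n. c i * a i)" "\<forall>i<n. c' i \<in> R" "y = (\<Sum>i<n. c' i * a i)"
    using assms(2,3) unfolding span_below_def by blast
  then show ?thesis
    unfolding span_below_def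
    by (auto intro!: exI[of _ "\<lambda>i. c i + c' i"] simp: sum.distrib algebra_simps subring_add[OF assms(1)])
qed

lemma span_below_mult:
  assumes "is_subring R" "r \<in> R" "x \<in> span_below R a n"
  shows "r * x \<in> span_below R a n"
proof -
  obtain c where "\<forall>i<n. c i \<in> R" "x = (\<Sum>i<n. c i * a i)"
    using assms(3) unfolding span_below_def by blast
  then show ?thesis
    unfolding span_below_def
    by (auto intro!: exI[of _ "\<lambda>i. r * c i"] simp: sum_distrib_left algebra_simps subring_mult[OF assms(1,2)])
qed

lemma span_below_0: "is_subring R \<Longrightarrow> 0 \<in> span_below R a n"
  unfolding span_below_def by (auto intro!: exI[of _ "\<lambda>_. 0"] subring_0)

lemma span_below_sum:
  "is_subring R \<Longrightarrow> (\<And>i. i \<in> I \<Longrightarrow> f i \<in> span_below R a n) \<Longrightarrow> sum f I \<in> span_below R a n"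
  by (induction I rule: infinite_finite_induct) (auto intro: span_below_0 span_below_add)

lemma span_below_base:
  assumes "is_subring R" "i < n" shows "a i \<in> span_below R a n"
proof -
  have "(\<Sum>j<n. (if j = i then 1 else 0) * a j) = (\<Sum>j<n. if j = i then a j else 0)"
    by (rule sum.cong) auto
  also have "\<dots> = a i" using assms(2) by simp
  finally have "a i = (\<Sum>j<n. (if j = i then 1 else 0) * a j)" by simp
  moreover have "\<forall>j<n. (if j = i then 1 else 0) \<in> R"
    using subring_0 subring_1 assms(1) by auto
  ultimately show ?thesis
    unfolding span_below_def by (intro CollectI exI[of _ "\<lambda>j. if j = i then 1 else 0"] conjI)
qed

lemma span_below_subsetI:
  assumes "is_subring R" "\<And>i. i < n \<Longrightarrow> b i \<in> span_below R a m"
  shows "span_below R b n \<subseteq> span_below R a m"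
  unfolding span_below_def[of R b]
  using assms by (auto intro!: span_below_sum span_below_mult)

lemma span_below_mono: "is_subring R \<Longrightarrow> m \<le> n \<Longrightarrow> span_below R a m \<subseteq> span_below R a n"
  by (rule span_below_subsetI) (auto intro: span_below_base)

lemma noetherian_subring_iff:
  "noetherian_subring R \<longleftrightarrow> is_subring R \<and> (\<forall>a. range a \<subseteq> R \<longrightarrow> (\<exists>n. a n \<in> span_below R a n))"
proof -
  have "(\<exists>c. (\<forall>i<n. c i \<in> R) \<and> a n = (\<Sum>i<n. c i * a i)) \<longleftrightarrow> a n \<in> span_below R a n" for a n
    unfolding span_below_def by auto
  then show ?thesis unfolding noetherian_subring_def by simp
qed

text \<open>Hilbert's basis theorem: among the polynomials whose values lie in the ideal generated by
  a bad sequence, choose successively one of least degree outside the ideal generated by the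
  previous ones. A relation between the leading coefficients contradicts the minimality.\<close>

lemma noetherian_adjoin:
  assumes noeth: "noetherian_subring R"
  shows "noetherian_subring (adjoin R x)"
proof -
  have R: "is_subring R" using noeth unfolding noetherian_subring_def by blast
  note P = is_subring_polys_over[OF R] and A = is_subring_adjoin[OF R, of x]
  have "\<exists>n. a n \<in> span_below (adjoin R x) a n" if a: "range a \<subseteq> adjoin R x" for a
  proof (rule ccontr)
    assume bad: "\<nexists>n. a n \<in> span_below (adjoin R x) a n"
    \<comment> \<open>\<open>I\<close> is the preimage, under evaluation at \<open>x\<close>, of the
      ideal generated by all \<open>a n\<close>. Elements of \<open>adjoin R x\<close> have no
      degree of their own, so the argument runs in the polynomials.\<close>
    define I where "I = {p \<in> polys_over R. \<exists>n. poly p x \<in> span_below (adjoin R x) a n}"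
    have I_diff: "p - q \<in> I" if pq: "p \<in> I" "q \<in> I" for p q
    proof -
      obtain m n where mn: "poly p x \<in> span_below (adjoin R x) a m" "poly q x \<in> span_below (adjoin R x) a n"
        using pq unfolding I_def by blast
      have "poly p x \<in> span_below (adjoin R x) a (max m n)"
        using mn(1) span_below_mono[OF A, of m "max m n" a] by auto
      moreover have "- 1 * poly q x \<in> span_below (adjoin R x) a (max m n)"
        using mn(2) span_below_mono[OF A, of n "max m n" a]
        by (intro span_below_mult[OF A]) (use subring_diff[OF A subring_0[OF A] subring_1[OF A]] in auto)
      ultimately have "poly (p - q) x \<in> span_below (adjoin R x) a (max m n)"
        using span_below_add[OF A] by fastforce
      then show ?thesis using pq subring_diff[OF P] unfolding I_def by blast
    qed
    have I_mult: "p * q \<in> I" if pq: "p \<in> polys_over R" "q \<in> I" for p q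
    proof -
      obtain n where "poly q x \<in> span_below (adjoin R x) a n" using pq unfolding I_def by blast
      then have "poly p x * poly q x \<in> span_below (adjoin R x) a n"
        using pq(1) by (intro span_below_mult[OF A]) (auto simp: adjoin_def)
      then show ?thesis using pq subring_mult[OF P] unfolding I_def by auto
    qed
    have I_0: "0 \<in> I" unfolding I_def using span_below_0[OF A] subring_0[OF P] by auto
    have I_sum: "sum f J \<in> I" if "\<And>i. i \<in> J \<Longrightarrow> f i \<in> I" for f :: "nat \<Rightarrow> 'a poly" and J
      using that
    proof (induction J rule: infinite_finite_induct)
      case (insert i J)
      then have "f i - (0 - sum f J) \<in> I" by (intro I_diff I_0) auto
      then show ?case using insert by simp
    qed (auto intro: I_0)
    \<comment> \<open>No finite family spans \<open>I\<close>: its values at \<open>x\<close> would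
      all lie in the span of the first \<open>M\<close> terms of \<open>a\<close>, and a polynomial
      representing \<open>a M\<close> would then put \<open>a M\<close> there too.\<close>
    have ex: "\<exists>p\<in>I. p \<notin> span_below (polys_over R) s n" if s: "\<And>i. i < n \<Longrightarrow> s i \<in> I" for s n
    proof (rule ccontr)
      assume "\<not> ?thesis"
      then have sub: "I \<subseteq> span_below (polys_over R) s n" by blast
      have "\<forall>i. \<exists>N. i < n \<longrightarrow> poly (s i) x \<in> span_below (adjoin R x) a N" using s unfolding I_def by blast
      then obtain N where N: "\<And>i. i < n \<Longrightarrow> poly (s i) x \<in> span_below (adjoin R x) a (N i)" by metis
      define M where "M = (\<Sum>i<n. N i)"
      have M: "poly (s i) x \<in> span_below (adjoin R x) a M" if "i < n" for i
      proof -
        have "N i \<le> M" unfolding M_def using that by (intro member_le_sum) auto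
        then show ?thesis using N[OF that] span_below_mono[OF A] by blast
      qed
      obtain q where q: "q \<in> polys_over R" "a M = poly q x" using a unfolding adjoin_def by blast
      have "q \<in> I" unfolding I_def using q span_below_base[OF A, of M "Suc M" a] by (metis (mono_tags, lifting) lessI mem_Collect_eq)
      then obtain c where c: "\<forall>i<n. c i \<in> polys_over R" "q = (\<Sum>i<n. c i * s i)"
        using sub unfolding span_below_def by blast
      have "poly q x = (\<Sum>i<n. poly (c i) x * poly (s i) x)" using c(2) by (simp add: poly_sum)
      also have "\<dots> \<in> span_below (adjoin R x) a M"
        using c(1) M by (intro span_below_sum[OF A] span_below_mult[OF A]) (auto simp: adjoin_def)
      finally show False using bad q(2) by metis
    qed
    define Q where "Q f n r \<longleftrightarrow> r \<in> I \<and> r \<notin> span_below (polys_over R) f n \<and>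
        (\<forall>q\<in>I. q \<notin> span_below (polys_over R) f n \<longrightarrow> degree r \<le> degree q)" for f n r
    have "\<exists>f. \<forall>n. Q f n (f n)"
    proof (rule dependent_wellorder_choice)
      fix r and f g :: "nat \<Rightarrow> 'a poly" and n :: nat assume "\<And>y. y < n \<Longrightarrow> f y = g y"
      then have "span_below (polys_over R) f n = span_below (polys_over R) g n"
        unfolding span_below_def by auto
      then show "Q f n r = Q g n r" unfolding Q_def by simp
    next
      fix n f assume "\<And>y. y < n \<Longrightarrow> Q f y (f y)"
      then obtain p where "p \<in> I \<and> p \<notin> span_below (polys_over R) f n"
        using ex[of n f] unfolding Q_def by blast
      then show "\<exists>r. Q f n r"
        using ex_has_least_nat[of "\<lambda>p. p \<in> I \<and> p \<notin> span_below (polys_over R) f n" p degree]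
        unfolding Q_def by blast
    qed
    then obtain p where p: "\<And>n. Q p n (p n)" by blast
    have pI: "p n \<in> I" and pR: "p n \<in> polys_over R" for n using p unfolding Q_def I_def by auto
    have deg: "degree (p i) \<le> degree (p n)" if "i < n" for i n
      using p[of i] p[of n] span_below_mono[OF P, of i n p] that unfolding Q_def by auto
    obtain n c where c: "\<And>i. i < n \<Longrightarrow> c i \<in> R" "lead_coeff (p n) = (\<Sum>i<n. c i * lead_coeff (p i))"
    proof -
      have "range (\<lambda>n. lead_coeff (p n)) \<subseteq> R" using pR unfolding polys_over_def by auto
      then show thesis using noeth that unfolding noetherian_subring_def by blast
    qed
    \<comment> \<open>The monomials raise each earlier \<open>p i\<close> to the degree of
      \<open>p n\<close>, so the relation between leading coefficients cancels the top term of
      \<open>p n - r\<close>. By \<open>deg\<close> the truncated subtraction is exact.\<close>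
    define r where "r = (\<Sum>i<n. monom (c i) (degree (p n) - degree (p i)) * p i)"
    have r_span: "r \<in> span_below (polys_over R) p n"
      unfolding r_def using c(1) by (intro span_below_sum[OF P] span_below_mult[OF P])
        (auto intro: monom_in_polys_over[OF R] span_below_base[OF P])
    have rI: "r \<in> I" unfolding r_def using c(1) by (intro I_sum I_mult pI) (auto intro: monom_in_polys_over[OF R])
    have nspan: "p n - r \<notin> span_below (polys_over R) p n"
      using p[of n] span_below_add[OF P r_span, of "p n - r"] unfolding Q_def by auto
    then have le: "degree (p n) \<le> degree (p n - r)"
      using p[of n] I_diff[OF pI rI] unfolding Q_def by blast
    have "degree r \<le> degree (p n)"
      unfolding r_def
    proof (rule degree_sum_le)
      fix i assume "i \<in> {..<n}"
      have "degree (monom (c i) (degree (p n) - degree (p i)) * p i)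
          \<le> degree (monom (c i) (degree (p n) - degree (p i))) + degree (p i)" by (rule degree_mult_le)
      also have "\<dots> \<le> (degree (p n) - degree (p i)) + degree (p i)" by (simp add: degree_monom_le)
      finally show "degree (monom (c i) (degree (p n) - degree (p i)) * p i) \<le> degree (p n)"
        using deg[of i n] \<open>i \<in> {..<n}\<close> by simp
    qed simp
    moreover have "coeff r (degree (p n)) = lead_coeff (p n)"
      unfolding r_def c(2) coeff_sum
    proof (rule sum.cong)
      fix i assume "i \<in> {..<n}"
      then have "degree (p i) \<le> degree (p n)" using deg by simp
      then show "coeff (monom (c i) (degree (p n) - degree (p i)) * p i) (degree (p n)) = c i * lead_coeff (p i)"
        by (simp add: coeff_monom_mult)
    qed simp
    \<comment> \<open>Minimality forbids a smaller degree, yet the coefficient in degree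
      \<open>degree (p n)\<close> vanishes; so \<open>p n - r\<close> is zero and hence in the
      span.\<close>
    ultimately have "coeff (p n - r) (degree (p n)) = 0" "degree (p n - r) = degree (p n)"
      using le degree_diff_le[of "p n" "degree (p n)" r] by simp_all
    then have "p n - r = 0" by (metis leading_coeff_0_iff)
    then show False using nspan span_below_0[OF P] by simp
  qed
  then show ?thesis using A unfolding noetherian_subring_iff by blast
qed

section \<open>Structure homomorphisms and affine algebras\<close>

lemma algebra_map_0: "algebra_map \<iota> \<Longrightarrow> \<iota> 0 = 0"
  unfolding algebra_map_def by (metis add_cancel_right_right)

lemma algebra_map_diff: "algebra_map \<iota> \<Longrightarrow> \<iota> (x - y) = \<iota> x - \<iota> y"
  unfolding algebra_map_def by (metis add_diff_cancel_right' diff_add_cancel)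

lemma algebra_map_inverse: "algebra_map \<iota> \<Longrightarrow> c \<noteq> 0 \<Longrightarrow> \<iota> c * \<iota> (inverse c) = 1"
  unfolding algebra_map_def by (metis right_inverse)

lemma algebra_map_of_nat: "algebra_map \<iota> \<Longrightarrow> \<iota> (of_nat n) = of_nat n"
  by (induction n) (auto simp: algebra_map_0, auto simp: algebra_map_def)

text \<open>The range is a field: either \<open>a 0 = 0\<close> is in the empty span, or
  \<open>a 0\<close> is invertible and \<open>a 1\<close> is a multiple of it.\<close>

lemma noetherian_range_algebra_map:
  fixes \<iota> :: "'k::field \<Rightarrow> 'a::comm_ring_1"
  assumes \<iota>: "algebra_map \<iota>"
  shows "noetherian_subring (range \<iota>)"
proof -
  have sr: "is_subring (range \<iota>)"
    unfolding is_subring_def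
  proof (intro conjI ballI)
    show "1 \<in> range \<iota>" using \<iota> unfolding algebra_map_def by (metis rangeI)
    fix x y assume "x \<in> range \<iota>" "y \<in> range \<iota>"
    then obtain u v where "x = \<iota> u" "y = \<iota> v" by blast
    then show "x - y \<in> range \<iota>" "x * y \<in> range \<iota>"
      using \<iota> algebra_map_diff[OF \<iota>, of u v] unfolding algebra_map_def by (metis rangeI)+
  qed
  have "\<exists>n. a n \<in> span_below (range \<iota>) a n" if a: "range a \<subseteq> range \<iota>" for a
  proof -
    obtain c where c: "a 0 = \<iota> c" using a by blast
    show ?thesis
    proof (cases "c = 0")
      case True
      then have "a 0 \<in> span_below (range \<iota>) a 0" using c algebra_map_0[OF \<iota>] span_below_0[OF sr] by metis
      then show ?thesis ..
    next
      case False
      have "a 1 = (a 1 * \<iota> (inverse c)) * a 0"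
        using algebra_map_inverse[OF \<iota> False] unfolding c by (metis mult.assoc mult.commute mult.right_neutral)
      also have "\<dots> \<in> span_below (range \<iota>) a 1"
        using a by (intro span_below_mult[OF sr] subring_mult[OF sr] span_below_base[OF sr]) auto
      finally show ?thesis ..
    qed
  qed
  then show ?thesis using sr unfolding noetherian_subring_iff by blast
qed

text \<open>Adjoin the finitely many generators in turn, starting from the image of the field; the
  result contains the hull.\<close>

lemma affine_algebra_noetherian:
  fixes \<iota> :: "'k::field \<Rightarrow> 'a::comm_ring_1"
  assumes "affine_algebra \<iota>"
  shows "noetherian_subring (UNIV :: 'a set)"
proof -
  obtain S where S: "finite S" "is_subring hull (range \<iota> \<union> S) = UNIV" and \<iota>: "algebra_map \<iota>"
    using assms unfolding affine_algebra_def by blast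
  have "\<exists>R. noetherian_subring R \<and> range \<iota> \<union> S \<subseteq> R"
    using S(1)
  proof induction
    case empty
    then show ?case using noetherian_range_algebra_map[OF \<iota>] by auto
  next
    case (insert x S)
    then obtain R where R: "noetherian_subring R" "range \<iota> \<union> S \<subseteq> R" by blast
    then have "is_subring R" unfolding noetherian_subring_def by blast
    then have "range \<iota> \<union> insert x S \<subseteq> adjoin R x"
      using R(2) subset_adjoin[of R x] in_adjoin[of R x] by blast
    then show ?case using noetherian_adjoin[OF R(1)] by blast
  qed
  then obtain R where R: "noetherian_subring R" "range \<iota> \<union> S \<subseteq> R" by blast
  then have "is_subring hull (range \<iota> \<union> S) \<subseteq> R"
    by (intro hull_minimal) (auto simp: noetherian_subring_def)
  then show ?thesis using R(1) S(2) by (simp add: top.extremum_unique)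
qed

text \<open>With \<open>f = w / v\<close>, all \<open>f ^ n * x\<close> are elements
  \<open>y n\<close> of the ring. A relation expressing \<open>y n\<close> by its predecessors
  becomes, after cancelling \<open>x\<close>, a monic equation for \<open>f\<close>; normality puts
  \<open>f\<close> into the ring.\<close>

lemma normal_noetherian_dvd:
  fixes v w x :: "'a::idom"
  assumes noeth: "noetherian_subring (UNIV :: 'a set)" and normal: "normal_domain TYPE('a)"
    and "v \<noteq> 0" "x \<noteq> 0" and dvd: "\<And>n. v ^ n dvd w ^ n * x"
  shows "v dvd w"
proof -
  obtain y where y: "\<And>n. w ^ n * x = v ^ n * y n" using dvd unfolding dvd_def by metis
  obtain n c where c: "y n = (\<Sum>i<n. c i * y i)"
    using noeth unfolding noetherian_subring_def by blast
  define f where "f = to_fract w / to_fract v"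
  have v0: "to_fract v \<noteq> 0" using \<open>v \<noteq> 0\<close> by simp
  have to_fract_power: "to_fract (z ^ i) = to_fract z ^ i" for z :: 'a and i
    by (induction i) auto
  have fy: "to_fract (y i) = f ^ i * to_fract x" for i
  proof -
    have "to_fract w ^ i * to_fract x = to_fract v ^ i * to_fract (y i)"
      using arg_cong[OF y[of i], of to_fract] by (simp add: to_fract_power)
    then show ?thesis unfolding f_def using v0 by (simp add: field_simps)
  qed
  have hom_sum: "to_fract (sum g J) = (\<Sum>i\<in>J. to_fract (g i))" for g :: "nat \<Rightarrow> 'a" and J
    by (induction J rule: infinite_finite_induct) auto
  have "f ^ n * to_fract x = (\<Sum>i<n. to_fract (c i) * f ^ i) * to_fract x"
    using arg_cong[OF c, of to_fract] by (simp add: fy hom_sum sum_distrib_right mult.assoc)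
  then have fn: "f ^ n = (\<Sum>i<n. to_fract (c i) * f ^ i)" using \<open>x \<noteq> 0\<close> by simp
  define q where "q = (\<Sum>i<n. monom (c i) i)"
  define p where "p = monom 1 n - q"
  have coeff_q: "coeff q j = (if j < n then c j else 0)" for j
    unfolding q_def coeff_sum by simp
  have coeff_p: "coeff p j = (if j = n then 1 else if j < n then - c j else 0)" for j
    unfolding p_def using coeff_q by auto
  have "degree p = n"
    by (rule antisym[OF degree_le le_degree]) (auto simp: coeff_p)
  then have lead: "lead_coeff p = 1" by (simp add: coeff_p)
  have "poly (map_poly to_fract p) f = (\<Sum>i\<le>n. to_fract (coeff p i) * f ^ i)"
  proof -
    have "degree (map_poly to_fract p) = n" using \<open>degree p = n\<close> by (simp add: degree_map_poly)
    then show ?thesis unfolding poly_altdef by (simp add: coeff_map_poly)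
  qed
  also have "\<dots> = (\<Sum>i<n. to_fract (coeff p i) * f ^ i) + f ^ n"
    by (simp add: lessThan_Suc_atMost[symmetric] coeff_p)
  also have "(\<Sum>i<n. to_fract (coeff p i) * f ^ i) = (\<Sum>i<n. - (to_fract (c i) * f ^ i))"
    by (rule sum.cong) (auto simp: coeff_p)
  finally have "poly (map_poly to_fract p) f = 0" using fn by (simp add: sum_negf)
  then have "integral_over_base f" unfolding integral_over_base_def using lead by blast
  then obtain z where "f = to_fract z" using normal unfolding normal_domain_def by blast
  then have "to_fract w = to_fract (z * v)" unfolding f_def using v0 by (simp add: field_simps)
  then show ?thesis by (metis dvd_triv_right to_fract_eq_iff)
qed

section \<open>Gradings\<close>

locale graded_domain =
  fixes B :: "int \<Rightarrow> 'b::idom set"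
  assumes grading: "is_grading B"
begin

lemma hom_0: "0 \<in> B i"
  and hom_diff: "x \<in> B i \<Longrightarrow> y \<in> B i \<Longrightarrow> x - y \<in> B i"
  and hom_mult: "x \<in> B i \<Longrightarrow> y \<in> B j \<Longrightarrow> x * y \<in> B (i + j)"
  using grading unfolding is_grading_def by blast+

lemma hom_add: "x \<in> B i \<Longrightarrow> y \<in> B i \<Longrightarrow> x + y \<in> B i"
  using hom_diff[of x i "0 - y"] hom_diff[of 0 i y] hom_0 by simp

lemma hom_sum: "(\<And>j. j \<in> J \<Longrightarrow> f j \<in> B i) \<Longrightarrow> sum f J \<in> B i"
  by (induction J rule: infinite_finite_induct) (auto intro: hom_0 hom_add)

definition cp :: "'b \<Rightarrow> int \<Rightarrow> 'b" where
  "cp b = (THE f. (\<forall>i. f i \<in> B i) \<and> finite {i. f i \<noteq> 0} \<and> b = (\<Sum>i | f i \<noteq> 0. f i))"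

abbreviation supp :: "'b \<Rightarrow> int set" where "supp b \<equiv> {i. cp b i \<noteq> 0}"

lemma ex1_cp: "\<exists>!f. (\<forall>i. f i \<in> B i) \<and> finite {i. f i \<noteq> 0} \<and> b = (\<Sum>i | f i \<noteq> 0. f i)"
  using grading unfolding is_grading_def by blast

lemma cp_in: "cp b i \<in> B i" and finite_supp: "finite (supp b)" and sum_cp: "(\<Sum>i\<in>supp b. cp b i) = b"
proof -
  have "(\<forall>i. cp b i \<in> B i) \<and> finite (supp b) \<and> b = (\<Sum>i\<in>supp b. cp b i)"
    unfolding cp_def by (rule theI'[OF ex1_cp])
  note * = this
  from * show "cp b i \<in> B i" by (elim conjE allE)
  from * show "finite (supp b)" by (elim conjE)
  from * show "(\<Sum>i\<in>supp b. cp b i) = b" by (elim conjE) (rule sym)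
qed

lemma sum_cp_superset: "finite I \<Longrightarrow> supp b \<subseteq> I \<Longrightarrow> (\<Sum>i\<in>I. cp b i) = b"
  by (rule trans[OF sum.mono_neutral_right sum_cp]) auto

lemma cp_eqI:
  assumes "\<And>i. f i \<in> B i" "finite I" "\<And>i. i \<notin> I \<Longrightarrow> f i = 0" "b = sum f I"
  shows "cp b = f"
proof -
  have sub: "{i. f i \<noteq> 0} \<subseteq> I" using assms(3) by blast
  then have "finite {i. f i \<noteq> 0}" using assms(2) finite_subset by blast
  moreover have "b = (\<Sum>i | f i \<noteq> 0. f i)"
    unfolding assms(4) using sub assms(2) by (intro sum.mono_neutral_right) auto
  ultimately show ?thesis
    unfolding cp_def using assms(1) by (intro the1_equality[OF ex1_cp]) auto
qed

lemma cp_add: "cp (a + b) i = cp a i + cp b i"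
proof -
  have "cp (a + b) = (\<lambda>i. cp a i + cp b i)"
    by (rule cp_eqI[where I = "supp a \<union> supp b"])
      (auto simp: hom_add cp_in finite_supp sum.distrib sum_cp_superset)
  then show ?thesis by simp
qed

lemma cp_hom: "b \<in> B i \<Longrightarrow> cp b j = (if j = i then b else 0)"
  by (subst cp_eqI[where I = "{i}" and f = "\<lambda>j. if j = i then b else 0"]) (auto simp: hom_0)

lemma cp_0: "cp 0 i = 0"
  using cp_hom[OF hom_0] by auto

lemma cp_diff: "cp (a - b) i = cp a i - cp b i"
  using cp_add[of "a - b" b i] by simp

lemma cp_sum: "cp (sum f J) i = (\<Sum>j\<in>J. cp (f j) i)"
  by (induction J rule: infinite_finite_induct) (auto simp: cp_0 cp_add)

lemma hom_iff: "b \<in> B i \<longleftrightarrow> (\<forall>j. j \<noteq> i \<longrightarrow> cp b j = 0)"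
proof
  assume "\<forall>j. j \<noteq> i \<longrightarrow> cp b j = 0"
  then have "supp b \<subseteq> {i}" by blast
  then have "cp b i = b" using sum_cp_superset[of "{i}" b] by simp
  then show "b \<in> B i" using cp_in by metis
qed (simp add: cp_hom)

lemma eq_iff_cp: "a = b \<longleftrightarrow> (\<forall>i. cp a i = cp b i)"
proof
  assume "\<forall>i. cp a i = cp b i"
  then have "cp a = cp b" by auto
  then show "a = b" using sum_cp by metis
qed simp

lemma cp_hom_mult:
  assumes "a \<in> B p" shows "cp (a * b) i = a * cp b (i - p)"
proof -
  have "cp (a * b) = (\<lambda>i. a * cp b (i - p))"
  proof (rule cp_eqI[where I = "(\<lambda>i. i + p) ` supp b"])
    show "a * cp b (i - p) \<in> B i" for i using hom_mult[OF assms cp_in, of b "i - p"] by simp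
    show "a * cp b (i - p) = 0" if "i \<notin> (\<lambda>i. i + p) ` supp b" for i
      using that by (force simp: image_iff)
    show "a * b = (\<Sum>i\<in>(\<lambda>i. i + p) ` supp b. a * cp b (i - p))"
      by (subst sum.reindex) (auto simp: inj_on_def sum_distrib_left[symmetric] sum_cp)
  qed (simp add: finite_supp)
  then show ?thesis by simp
qed

lemma cp_mult: "cp (a * b) i = (\<Sum>j\<in>supp a. cp a j * cp b (i - j))"
proof -
  have "cp (a * b) i = cp (\<Sum>j\<in>supp a. cp a j * b) i"
    by (simp add: sum_distrib_right[symmetric] sum_cp)
  then show ?thesis by (simp add: cp_sum cp_hom_mult[OF cp_in])
qed

text \<open>The component of 1 in degree 0 is an identity on every homogeneous element, as a
  comparison of components in \<open>x * 1 = x\<close> shows, hence also on 1.\<close>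

lemma hom_1: "1 \<in> B 0"
proof -
  have e: "x * cp 1 0 = x" if "x \<in> B i" for x i
    using cp_hom_mult[OF that, of 1 i] cp_hom[OF that, of i] by simp
  have "1 * cp 1 0 = (\<Sum>j\<in>supp 1. cp 1 j * cp 1 0)"
    by (simp only: sum_distrib_right[symmetric] sum_cp)
  also have "\<dots> = 1" by (simp add: e[OF cp_in] sum_cp)
  finally show ?thesis using cp_in[of 1 0] by simp
qed

lemma hom_power: "x \<in> B i \<Longrightarrow> x ^ n \<in> B (int n * i)"
proof (induction n)
  case (Suc n)
  then have "x * x ^ n \<in> B (i + int n * i)" by (intro hom_mult) auto
  then show ?case by (simp add: algebra_simps)
qed (simp add: hom_1)

lemma hom_of_nat: "of_nat n \<in> B 0"
  by (induction n) (auto intro: hom_0 hom_add hom_1)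

lemma hom_of_nat_mult: "x \<in> B i \<Longrightarrow> of_nat n * x \<in> B i"
  using hom_mult[OF hom_of_nat, of x i n] by simp

text \<open>Meant for \<open>p\<close>, \<open>q\<close> both maximal or both minimal in the
  supports, where only one summand of the product formula survives.\<close>

lemma cp_mult_extreme:
  assumes "\<And>i j. i + j = p + q \<Longrightarrow> i \<noteq> p \<Longrightarrow> cp a i = 0 \<or> cp b j = 0"
  shows "cp (a * b) (p + q) = cp a p * cp b q"
proof (cases "cp a p = 0")
  case True
  have "cp a j * cp b (p + q - j) = 0" for j
    using assms[of j "p + q - j"] True by (cases "j = p") auto
  then show ?thesis unfolding cp_mult by (simp only: sum.neutral_const) (simp add: True)
next
  case False
  have "cp a j * cp b (p + q - j) = (if j = p then cp a p * cp b q else 0)" for j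
    using assms[of j "p + q - j"] by auto
  then show ?thesis unfolding cp_mult using False by (simp add: finite_supp)
qed

lemma supp_nonempty: "b \<noteq> 0 \<Longrightarrow> supp b \<noteq> {}"
  using eq_iff_cp[of b 0] by (auto simp: cp_0)

text \<open>In a domain the top components multiply to a nonzero component of 1, and so do the
  bottom ones. Both therefore sit in degree 0, which forces top and bottom degree of
  \<open>u\<close> to agree.\<close>

lemma unit_homogeneous:
  assumes "u * v = 1" shows "\<exists>i. u \<in> B i"
proof -
  have nz: "u \<noteq> 0" "v \<noteq> 0" using assms by auto
  have extreme: "p + q = 0" if "cp u p \<noteq> 0" "cp v q \<noteq> 0"
      "\<And>i j. i + j = p + q \<Longrightarrow> i \<noteq> p \<Longrightarrow> cp u i = 0 \<or> cp v j = 0" for p q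
  proof -
    have "cp (u * v) (p + q) \<noteq> 0" using cp_mult_extreme[of p q u v] that by simp
    then show ?thesis unfolding assms using cp_hom[OF hom_1, of "p + q"] by (auto split: if_splits)
  qed
  define p q p' q' where "p = Max (supp u)" and "q = Max (supp v)" and "p' = Min (supp u)" and "q' = Min (supp v)"
  have in_supp: "cp u p \<noteq> 0" "cp v q \<noteq> 0" "cp u p' \<noteq> 0" "cp v q' \<noteq> 0"
    unfolding p_def q_def p'_def q'_def
    using Max_in[OF finite_supp supp_nonempty] Min_in[OF finite_supp supp_nonempty] nz by auto
  have max: "cp u i \<noteq> 0 \<Longrightarrow> p' \<le> i \<and> i \<le> p" "cp v i \<noteq> 0 \<Longrightarrow> q' \<le> i \<and> i \<le> q" for i
    unfolding p_def q_def p'_def q'_def by (auto simp: finite_supp)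
  have "p + q = 0" "p' + q' = 0"
    by (rule extreme; use in_supp max in force)+
  moreover have "p' \<le> p" "q' \<le> q" using max in_supp by auto
  ultimately have "p' = p" by simp
  then have "u \<in> B p" unfolding hom_iff using max(1) by force
  then show ?thesis ..
qed

text \<open>Nonzero scalars are units, hence homogeneous. If \<open>\<iota> c\<close> were nonzero
  of degree \<open>i \<noteq> 0\<close>, then \<open>\<iota> c + 1\<close>, also a scalar, would
  have two nonzero components.\<close>

lemma algebra_map_hom_0:
  fixes \<iota> :: "'k::field \<Rightarrow> 'b"
  assumes \<iota>: "algebra_map \<iota>" shows "\<iota> c \<in> B 0"
proof -
  have hom: "\<exists>i. \<iota> c \<in> B i" for c
    using unit_homogeneous[OF algebra_map_inverse[OF \<iota>]] algebra_map_0[OF \<iota>] hom_0 by (cases "c = 0") auto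
  obtain i where i: "\<iota> c \<in> B i" using hom by blast
  have \<iota>1: "\<iota> (c + 1) = \<iota> c + 1" using \<iota> unfolding algebra_map_def by simp
  show ?thesis
  proof (cases "\<iota> c = 0 \<or> i = 0")
    case False
    obtain j where j: "\<iota> (c + 1) \<in> B j" using hom by blast
    have "cp (\<iota> (c + 1)) i = \<iota> c" "cp (\<iota> (c + 1)) 0 = 1"
      using False cp_hom[OF i] cp_hom[OF hom_1] unfolding \<iota>1 cp_add by auto
    then have "i = j" "0 = j" using cp_hom[OF j] False by (metis, metis zero_neq_one)
    then show ?thesis using i by simp
  qed (use i hom_0 in auto)
qed

section \<open>Veronese subrings\<close>

lemma veronese_iff: "b \<in> veronese d B \<longleftrightarrow> (\<forall>i. cp b i \<noteq> 0 \<longrightarrow> int d dvd i)"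
proof
  assume "b \<in> veronese d B"
  then obtain I f where I: "finite I" "\<forall>i\<in>I. int d dvd i \<and> f i \<in> B i" "b = (\<Sum>i\<in>I. f i)"
    unfolding veronese_def by blast
  have "cp b = (\<lambda>i. if i \<in> I then f i else 0)"
    by (rule cp_eqI[where I = I]) (use I hom_0 in auto)
  then show "\<forall>i. cp b i \<noteq> 0 \<longrightarrow> int d dvd i" using I by simp
next
  assume "\<forall>i. cp b i \<noteq> 0 \<longrightarrow> int d dvd i"
  then have "\<exists>I f. b = (\<Sum>i\<in>I. f i) \<and> finite I \<and> (\<forall>i\<in>I. int d dvd i \<and> f i \<in> B i)"
    by (intro exI[of _ "supp b"] exI[of _ "cp b"]) (auto simp: sum_cp finite_supp cp_in)
  then show "b \<in> veronese d B" unfolding veronese_def by blast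
qed

lemma hom_in_veronese: "b \<in> B i \<Longrightarrow> int d dvd i \<Longrightarrow> b \<in> veronese d B"
  unfolding veronese_iff by (simp add: cp_hom)

lemma cp_in_veronese: "b \<in> veronese d B \<Longrightarrow> cp b i \<in> veronese d B"
  by (cases "cp b i = 0") (auto simp: veronese_iff cp_0 cp_hom[OF cp_in])

lemma is_subring_veronese: "is_subring (veronese d B)"
  unfolding is_subring_def
proof (intro conjI ballI)
  show "1 \<in> veronese d B" by (rule hom_in_veronese[OF hom_1]) simp
  fix x y assume xy: "x \<in> veronese d B" "y \<in> veronese d B"
  then show "x - y \<in> veronese d B" unfolding veronese_iff cp_diff by (metis diff_self)
  show "x * y \<in> veronese d B"
    unfolding veronese_iff
  proof (intro allI impI)
    fix i assume "cp (x * y) i \<noteq> 0"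
    then obtain j where "cp x j * cp y (i - j) \<noteq> 0"
      unfolding cp_mult using sum.not_neutral_contains_not_neutral by blast
    then have "int d dvd j" "int d dvd i - j" using xy unfolding veronese_iff by auto
    then show "int d dvd i" using dvd_add[of "int d" "i - j" j] by simp
  qed
qed

lemma veronese_1: "veronese 1 B = UNIV"
  by (auto simp: veronese_iff)

section \<open>Homogeneous ideals and primes\<close>

lemma homogeneous_idealI:
  assumes "is_ideal P" "\<And>b i. b \<in> P \<Longrightarrow> cp b i \<in> P"
  shows "homogeneous_ideal B P"
proof -
  have "is_ideal hull (P \<inter> (\<Union>i. B i)) = P"
  proof (rule hull_unique)
    fix Q assume Q: "P \<inter> (\<Union>i. B i) \<subseteq> Q" "is_ideal Q"
    have sum: "sum f J \<in> Q" if "\<And>i. i \<in> J \<Longrightarrow> f i \<in> Q" for f :: "int \<Rightarrow> 'b" and J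
      using that Q(2) by (induction J rule: infinite_finite_induct) (auto simp: is_ideal_def)
    show "P \<subseteq> Q"
    proof
      fix b assume "b \<in> P"
      then have "(\<Sum>i\<in>supp b. cp b i) \<in> Q" using Q(1) assms(2) cp_in by (intro sum) blast
      then show "b \<in> Q" by (simp add: sum_cp)
    qed
  qed (use assms in auto)
  then show ?thesis unfolding homogeneous_ideal_def by (metis inf_le2)
qed

text \<open>Compare the top components outside \<open>P\<close> of two elements.\<close>

lemma prime_idealI_homogeneous:
  assumes P: "is_ideal P" "P \<noteq> UNIV" and cp_P: "\<And>b i. b \<in> P \<Longrightarrow> cp b i \<in> P"
    and prime: "\<And>x y i j. x \<in> B i \<Longrightarrow> y \<in> B j \<Longrightarrow> x * y \<in> P \<Longrightarrow> x \<in> P \<or> y \<in> P"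
  shows "is_prime_ideal P"
proof -
  have sumP: "sum f J \<in> P" if "\<And>i. i \<in> J \<Longrightarrow> f i \<in> P" for f :: "int \<Rightarrow> 'b" and J
    using that P(1) by (induction J rule: infinite_finite_induct) (auto simp: is_ideal_def)
  have P0: "0 \<in> P" and addP: "x \<in> P \<Longrightarrow> y \<in> P \<Longrightarrow> x + y \<in> P" and multP: "x \<in> P \<Longrightarrow> r * x \<in> P" for x y r
    using P(1) unfolding is_ideal_def by auto
  have top: "\<exists>p. cp b p \<notin> P \<and> (\<forall>i>p. cp b i \<in> P)" if "b \<notin> P" for b
  proof -
    define I where "I = {i. cp b i \<notin> P}"
    have "I \<subseteq> supp b" unfolding I_def using P0 by auto
    then have fin: "finite I" using finite_supp finite_subset by blast
    have "I \<noteq> {}" using sumP[of "supp b" "cp b"] that unfolding I_def sum_cp by blast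
    then have "Max I \<in> I" using fin by (intro Max_in)
    moreover have "i \<notin> I" if "i > Max I" for i using that fin Max_ge leD by blast
    ultimately show ?thesis unfolding I_def by blast
  qed
  have "x \<in> P \<or> y \<in> P" if xy: "x * y \<in> P" for x y
  proof (rule ccontr)
    assume "\<not> ?thesis"
    then have "x \<notin> P" "y \<notin> P" by auto
    obtain p where p: "cp x p \<notin> P" "\<And>i. i > p \<Longrightarrow> cp x i \<in> P" using top[OF \<open>x \<notin> P\<close>] by blast
    obtain q where q: "cp y q \<notin> P" "\<And>i. i > q \<Longrightarrow> cp y i \<in> P" using top[OF \<open>y \<notin> P\<close>] by blast
    have "p \<in> supp x" using p(1) P0 by auto
    then have "cp (x * y) (p + q) = cp x p * cp y q + (\<Sum>j\<in>supp x - {p}. cp x j * cp y (p + q - j))"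
      unfolding cp_mult by (subst sum.remove[OF finite_supp]) auto
    moreover have "(\<Sum>j\<in>supp x - {p}. cp x j * cp y (p + q - j)) \<in> P"
    proof (rule sumP)
      fix j assume "j \<in> supp x - {p}"
      \<comment> \<open>If \<open>j < p\<close>, the complementary degree exceeds \<open>q\<close>.
        Either way one factor lies beyond the top component outside \<open>P\<close>, hence in
        \<open>P\<close>.\<close>
      then consider "j > p" | "p + q - j > q" by force
      then show "cp x j * cp y (p + q - j) \<in> P"
        using multP[OF p(2)[of j], of "cp y (p + q - j)"] multP[OF q(2)[of "p + q - j"], of "cp x j"]
        by cases (simp_all add: mult.commute)
    qed
    ultimately have "cp (x * y) (p + q) + (- 1) * (cp (x * y) (p + q) - cp x p * cp y q) \<in> P"
      by (intro addP multP cp_P[OF xy]) simp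
    then have "cp x p * cp y q \<in> P" by simp
    then show False using prime[OF cp_in cp_in] p(1) q(1) by blast
  qed
  then show ?thesis unfolding is_prime_ideal_def using P by blast
qed

end

section \<open>Height one, and residues of a semigroup of degrees\<close>

lemma zero_ideal_prime: "is_prime_ideal {0 :: 'a::idom}"
  unfolding is_prime_ideal_def is_ideal_def by (auto dest: arg_cong[of _ _ "\<lambda>A. 1 \<in> A"])

lemma ideal_height_eq_1:
  fixes P :: "'a::idom set"
  assumes P: "is_prime_ideal P" "P \<noteq> {0}"
    and min: "\<And>Q. is_prime_ideal Q \<Longrightarrow> Q \<subset> P \<Longrightarrow> Q = {0}"
  shows "ideal_height P = 1"
  unfolding ideal_height_def
proof (rule antisym)
  let ?C = "\<lambda>n c. (\<forall>i\<le>n. is_prime_ideal (c i)) \<and> (\<forall>i<n. c i \<subset> c (Suc i)) \<and> c n = P"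
  show "Sup {enat n |n. \<exists>c. ?C n c} \<le> 1"
  proof (rule Sup_least, clarify)
    fix n and c :: "nat \<Rightarrow> 'a set" assume c: "\<forall>i\<le>n. is_prime_ideal (c i)" "\<forall>i<n. c i \<subset> c (Suc i)" "P = c n"
    have "n \<le> 1"
    proof (rule ccontr)
      \<comment> \<open>With two strict inclusions at the end, \<open>min\<close> makes the member
        just below \<open>P\<close> equal to \<open>{0}\<close>, leaving only the empty set beneath
        it.\<close>
      assume "\<not> n \<le> 1"
      then obtain m where m: "n = Suc (Suc m)" using nat_le_iff_add[of 2 n] by auto
      have prime: "is_prime_ideal (c m)" "is_prime_ideal (c (Suc m))" using c(1) m by simp_all
      have "c (Suc m) \<subset> c (Suc (Suc m))" "c m \<subset> c (Suc m)" using c(2) m by simp_all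
      then have "c (Suc m) = {0}" using min[OF prime(2)] c(3) m by simp
      with \<open>c m \<subset> c (Suc m)\<close> have "c m = {}" by (auto simp: psubset_eq subset_singleton_iff)
      moreover have "0 \<in> c m" using prime(1) unfolding is_prime_ideal_def is_ideal_def by blast
      ultimately show False by simp
    qed
    then show "enat n \<le> 1" by (simp add: one_enat_def)
  qed
  have "{0} \<subset> P" using P unfolding is_prime_ideal_def is_ideal_def by (metis empty_subsetI insert_subset psubsetI)
  then have "?C 1 (\<lambda>i. if i = 0 then {0} else P)"
    using P zero_ideal_prime by simp
  then have "\<exists>c. ?C 1 c" by (intro exI[of _ "\<lambda>i. if i = 0 then {0} else P"])
  then have "1 \<in> {enat n |n. \<exists>c. ?C n c}" by (intro CollectI exI[of _ 1]) (simp add: one_enat_def)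
  then show "1 \<le> Sup {enat n |n. \<exists>c. ?C n c}" by (rule Sup_upper)
qed

text \<open>Modulo \<open>d\<close>, the semigroup \<open>T\<close> is a subgroup of \<open>\<int>/d\<close>, so it contains every multiple of \<open>Gcd T\<close>.\<close>

lemma semigroup_residues:
  fixes T :: "int set" and d :: nat
  assumes "0 \<in> T" and add: "\<And>s t. s \<in> T \<Longrightarrow> t \<in> T \<Longrightarrow> s + t \<in> T"
    and "Gcd T dvd i" and "d > 0"
  shows "\<exists>t\<in>T. int d dvd t + i"
proof -
  \<comment> \<open>The integers congruent modulo \<open>d\<close> to an element of
    \<open>T\<close>. Negatives come from \<open>- x = (d - 1) x\<close> modulo \<open>d\<close>, so
    \<open>H\<close> is a subgroup of the integers containing \<open>d\<close>.\<close>
  define H where "H = {z. \<exists>t\<in>T. int d dvd t - z}"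
  have H_add: "x + y \<in> H" if xy: "x \<in> H" "y \<in> H" for x y
  proof -
    obtain s t where st: "s \<in> T" "t \<in> T" "int d dvd s - x" "int d dvd t - y" using xy unfolding H_def by blast
    then have "int d dvd (s + t) - (x + y)" using dvd_add[OF st(3,4)] by (simp add: algebra_simps)
    then show ?thesis using add st unfolding H_def by blast
  qed
  have H_0: "0 \<in> H" unfolding H_def using assms(1) by auto
  have nat_mult: "int n * x \<in> H" if "x \<in> H" for n x
    by (induction n) (use that H_0 H_add in \<open>auto simp: algebra_simps\<close>)
  have H_cong: "y \<in> H" if xy: "x \<in> H" "int d dvd x - y" for x y
  proof -
    obtain s where st: "s \<in> T" "int d dvd s - x" using xy unfolding H_def by blast
    then have "int d dvd s - y" using dvd_add[OF st(2) xy(2)] by (simp add: algebra_simps)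
    then show ?thesis using st unfolding H_def by blast
  qed
  have H_neg: "- x \<in> H" if "x \<in> H" for x
    by (rule H_cong[OF nat_mult[OF that, of "d - 1"]])
      (use \<open>d > 0\<close> in \<open>auto simp: of_nat_diff algebra_simps\<close>)
  have H_mult: "k * x \<in> H" if "x \<in> H" for k x
    using nat_mult[OF that, of "nat \<bar>k\<bar>"] H_neg[OF nat_mult[OF that, of "nat \<bar>k\<bar>"]] by (cases "k \<ge> 0") auto
  have "int d \<in> H" by (rule H_cong[OF H_0]) simp
  then have "\<exists>g. g > 0 \<and> int g \<in> H" using \<open>d > 0\<close> by blast
  \<comment> \<open>The least positive element of \<open>H\<close> divides all of \<open>H\<close>,
    hence \<open>Gcd T\<close>, hence \<open>i\<close>; so \<open>- i\<close> is in
    \<open>H\<close>.\<close>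
  then obtain g where g: "g > 0" "int g \<in> H" and least: "\<And>h. h > 0 \<Longrightarrow> int h \<in> H \<Longrightarrow> g \<le> h"
    using exists_least_iff[of "\<lambda>g. g > 0 \<and> int g \<in> H"] by (meson not_le)
  have dvdH: "int g dvd x" if "x \<in> H" for x
  proof (rule ccontr)
    assume "\<not> int g dvd x"
    then have pos: "x mod int g > 0" using g(1) by (metis dvd_eq_mod_eq_0 of_nat_0_less_iff pos_mod_sign order_le_imp_less_or_eq)
    have "x + (- (x div int g)) * int g \<in> H" by (intro H_add that H_mult g)
    then have "x mod int g \<in> H" by (simp add: minus_div_mult_eq_mod[symmetric])
    then have "g \<le> nat (x mod int g)" using pos by (intro least) auto
    then show False using pos_mod_bound[of "int g" x] g(1) pos by linarith
  qed
  have "T \<subseteq> H"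
  proof
    fix t assume "t \<in> T"
    then show "t \<in> H" unfolding H_def by (intro CollectI bexI[of _ t]) auto
  qed
  then have "int g dvd Gcd T" using dvdH by (intro Gcd_greatest) blast
  then have "int g dvd - i" using assms(3) dvd_trans by auto
  then obtain k where k: "- i = int g * k" unfolding dvd_def by blast
  have "- i \<in> H" unfolding k using H_mult[OF g(2), of k] by (simp only: mult.commute)
  then show ?thesis unfolding H_def by simp
qed

section \<open>Divisibility in normal noetherian graded domains\<close>

text \<open>Otherwise there is a strictly increasing chain \<open>f\<close>; picking
  \<open>a n\<close> in \<open>f (Suc n)\<close> outside \<open>f n\<close> gives a sequence none of
  whose terms is generated by its predecessors.\<close>

lemma noetherian_maximal:
  fixes F :: "'a::comm_ring_1 set set"
  assumes noeth: "noetherian_subring (UNIV :: 'a set)" and "F \<noteq> {}" and ideals: "\<And>I. I \<in> F \<Longrightarrow> is_ideal I"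
  shows "\<exists>M\<in>F. \<forall>I\<in>F. M \<subseteq> I \<longrightarrow> I = M"
proof (rule ccontr)
  assume "\<not> ?thesis"
  then have next_ideal: "\<exists>I\<in>F. M \<subset> I" if "M \<in> F" for M using that by blast
  have "\<exists>f. \<forall>n::nat. f n \<in> F \<and> f n \<subset> f (Suc n)"
    by (rule dependent_nat_choice) (use \<open>F \<noteq> {}\<close> next_ideal in auto)
  then obtain f where f: "\<And>n::nat. f n \<in> F" "\<And>n. f n \<subset> f (Suc n)" by blast
  then have "\<exists>a. \<forall>n. a n \<in> f (Suc n) \<and> a n \<notin> f n" by (intro choice) blast
  then obtain a where a: "\<And>n. a n \<in> f (Suc n)" "\<And>n. a n \<notin> f n" by blast
  obtain n c where c: "a n = (\<Sum>i<n. c i * a i)"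
    using noeth unfolding noetherian_subring_def by blast
  have mono: "f m \<subseteq> f n" if "m \<le> n" for m n
    by (rule lift_Suc_mono_le[OF _ that]) (use f(2) in blast)
  have I: "is_ideal (f n)" using ideals f(1) by blast
  have sum: "sum g J \<in> f n" if "\<And>i. i \<in> J \<Longrightarrow> g i \<in> f n" for g :: "nat \<Rightarrow> 'a" and J
    using that I by (induction J rule: infinite_finite_induct) (auto simp: is_ideal_def)
  have "a i \<in> f n" if "i < n" for i using a(1)[of i] mono[of "Suc i" n] that by auto
  then have "(\<Sum>i<n. c i * a i) \<in> f n" using I by (intro sum) (auto simp: is_ideal_def)
  then show False using a(2) c by metis
qed

lemma elt_set_plus_eq_iff:
  assumes "is_ideal P" shows "b +o P = 0 +o P \<longleftrightarrow> b \<in> P"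
proof
  assume eq: "b +o P = 0 +o P"
  have "b + 0 \<in> b +o P" using assms unfolding is_ideal_def by (intro set_plus_intro2) blast
  then show "b \<in> P" using eq by (auto simp: elt_set_plus_def)
next
  assume b: "b \<in> P"
  have neg: "- b \<in> P" and add: "x \<in> P \<Longrightarrow> y \<in> P \<Longrightarrow> x + y \<in> P" for x y
    using assms b unfolding is_ideal_def by (metis mult_minus1, blast)
  have "x \<in> b +o P" if "x \<in> P" for x
    using set_plus_intro2[of "- b + x" P b] add[OF neg that] by simp
  then show "b +o P = 0 +o P" using add[OF b] by (auto simp: elt_set_plus_def)
qed

context graded_domain
begin

text \<open>Trades cosets for elements: \<open>b +o P\<close> is the zero coset exactly for
  \<open>b\<close> in \<open>P\<close>.\<close>

lemma e_quotient_eq: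
  assumes "is_ideal P" shows "e_quotient B P = Gcd {n. \<exists>b\<in>B n. b \<notin> P}"
proof -
  have "quotient_component B P n \<noteq> {0 +o P} \<longleftrightarrow> (\<exists>b\<in>B n. b \<notin> P)" for n
    unfolding quotient_component_def elt_set_plus_eq_iff[OF assms, symmetric]
    using hom_0[of n] by auto
  then show ?thesis unfolding e_quotient_def grading_gcd_def by simp
qed

lemma e_ring_dvd: "b \<in> B i \<Longrightarrow> b \<noteq> 0 \<Longrightarrow> e_ring B dvd i"
  unfolding e_ring_def grading_gcd_def by (rule Gcd_dvd) auto

lemma e_quotient_dvd:
  assumes "saturated_in_codim_1 B" "P \<in> height_one_homogeneous_primes B"
  shows "e_quotient B P dvd e_ring B"
proof -
  have "e_quotient B P dvd e_bar B"
    unfolding e_bar_def using assms(2) by (auto intro: dvd_Lcm)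
  then show ?thesis using assms(1) unfolding saturated_in_codim_1_def by simp
qed

text \<open>Because \<open>P\<close> is prime, the degrees of homogeneous elements outside it form a
  semigroup containing 0. Its gcd is \<open>e_quotient B P\<close>, which by saturation divides
  \<open>e_ring B\<close> and hence \<open>i\<close>, so the semigroup meets the class of
  \<open>- i\<close> modulo \<open>d\<close>.\<close>

lemma exists_homogeneous_residue:
  assumes sat: "saturated_in_codim_1 B" and P: "P \<in> height_one_homogeneous_primes B"
    and b: "b \<in> B i" "b \<noteq> 0" and "d > 0"
  shows "\<exists>s j. s \<in> B j \<and> s \<notin> P \<and> int d dvd j + i"
proof -
  define T where "T = {n. \<exists>b\<in>B n. b \<notin> P}"
  have prime: "is_prime_ideal P" using P unfolding height_one_homogeneous_primes_def by blast
  have "1 \<notin> P"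
  proof
    assume "1 \<in> P"
    then have "x \<in> P" for x using prime unfolding is_prime_ideal_def is_ideal_def by (metis mult.right_neutral)
    then show False using prime unfolding is_prime_ideal_def by blast
  qed
  then have "0 \<in> T" unfolding T_def using hom_1 by blast
  moreover have "m + n \<in> T" if "m \<in> T" "n \<in> T" for m n
  proof -
    obtain x y where "x \<in> B m" "x \<notin> P" "y \<in> B n" "y \<notin> P" using \<open>m \<in> T\<close> \<open>n \<in> T\<close> unfolding T_def by blast
    then have "x * y \<in> B (m + n)" "x * y \<notin> P" using hom_mult prime unfolding is_prime_ideal_def by blast+
    then show ?thesis unfolding T_def by blast
  qed
  moreover have "Gcd T dvd i"
    using dvd_trans[OF e_quotient_dvd[OF sat P] e_ring_dvd[OF b]] e_quotient_eq[of P] prime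
    unfolding T_def is_prime_ideal_def by simp
  ultimately have "\<exists>t\<in>T. int d dvd t + i" using \<open>d > 0\<close> by (intro semigroup_residues)
  then show ?thesis unfolding T_def by blast
qed

text \<open>A maximal proper ideal among the \<open>(v : w)\<close> with \<open>w\<close> homogeneous is a homogeneous prime.
  It has height 1 because a nonzero ideal stable under multiplication by \<open>w / v\<close> would make
  \<open>w / v\<close> integral.\<close>

lemma dvd_if_locally_dvd:
  assumes noeth: "noetherian_subring (UNIV :: 'b set)" and normal: "normal_domain TYPE('b)"
    and v: "v \<in> B p" "v \<noteq> 0" and u: "u \<in> B q"
    and loc: "\<And>P. P \<in> height_one_homogeneous_primes B \<Longrightarrow> \<exists>s. s \<notin> P \<and> v dvd s * u"
  shows "v dvd u"
proof (rule ccontr)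
  assume ndvd: "\<not> v dvd u"
  define colon where "colon w = {s. v dvd s * w}" for w
  \<comment> \<open>Keeping only those \<open>w\<close> whose colon ideal contains
    \<open>colon u\<close> yields \<open>colon u \<subseteq> P\<close> for the prime found, against
    \<open>loc\<close>.\<close>
  define W where "W = {w. (\<exists>i. w \<in> B i) \<and> \<not> v dvd w \<and> colon u \<subseteq> colon w}"
  have ideal: "is_ideal (colon w)" for w
    unfolding is_ideal_def colon_def by (auto simp: distrib_right mult.assoc)
  have "u \<in> W" unfolding W_def using ndvd u by blast
  then have "\<exists>M\<in>colon ` W. \<forall>I\<in>colon ` W. M \<subseteq> I \<longrightarrow> I = M"
    by (intro noetherian_maximal[OF noeth]) (auto intro: ideal)
  then obtain w where w: "w \<in> W" and max: "\<And>w'. w' \<in> W \<Longrightarrow> colon w \<subseteq> colon w' \<Longrightarrow> colon w' = colon w" by blast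
  define P where "P = colon w"
  obtain i where wi: "w \<in> B i" and nw: "\<not> v dvd w" and uw: "colon u \<subseteq> P"
    using w unfolding W_def P_def by blast
  have P_ideal: "is_ideal P" unfolding P_def by (rule ideal)
  have "1 \<notin> P" unfolding P_def colon_def using nw by simp
  have cpP: "cp b j \<in> P" if b: "b \<in> P" for b j
  proof -
    obtain z where z: "w * b = v * z" using b unfolding P_def colon_def by (auto simp: dvd_def mult.commute)
    have "w * cp b j = v * cp z (j + i - p)"
      using cp_hom_mult[OF wi, of b "j + i"] cp_hom_mult[OF v(1), of z "j + i"] z by simp
    then show ?thesis unfolding P_def colon_def by (auto simp: mult.commute)
  qed
  have prime: "is_prime_ideal P"
  proof (rule prime_idealI_homogeneous[OF P_ideal])
    show "P \<noteq> UNIV" using \<open>1 \<notin> P\<close> by blast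
    fix x y j k assume xy: "x \<in> B j" "y \<in> B k" "x * y \<in> P"
    show "x \<in> P \<or> y \<in> P"
    proof (rule disjCI)
      assume "y \<notin> P"
      \<comment> \<open>So \<open>y * w\<close> is again in \<open>W\<close> with a colon ideal
        containing that of \<open>w\<close>; by maximality the two agree, and \<open>x\<close> lies
        in the former.\<close>
      then have "\<not> v dvd y * w" unfolding P_def colon_def by blast
      moreover have sub: "colon w \<subseteq> colon (y * w)"
        unfolding colon_def by (auto simp: mult.left_commute[of _ y w])
      ultimately have "y * w \<in> W"
        using hom_mult[OF xy(2) wi] uw unfolding W_def P_def by blast
      then have "colon (y * w) = P" using max[OF _ sub] unfolding P_def by blast
      then show "x \<in> P" using xy(3) unfolding P_def colon_def by (auto simp: mult.assoc)
    qed
  qed (rule cpP)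
  \<comment> \<open>Iterating \<open>w / v\<close> on \<open>x\<close> stays inside
    \<open>Q\<close>, so each \<open>w ^ n * x\<close> is a multiple of \<open>v ^ n\<close>; then
    \<open>w / v\<close> is integral and \<open>v dvd w\<close>.\<close>
  have not_stable: False
    if Q: "x \<in> Q" "x \<noteq> 0" "Q \<subseteq> P" and stable: "\<And>s z. s \<in> Q \<Longrightarrow> s * w = v * z \<Longrightarrow> z \<in> Q" for x Q
  proof -
    have "\<exists>z\<in>Q. w ^ n * x = v ^ n * z" for n
    proof (induction n)
      case 0
      then show ?case using Q by auto
    next
      case (Suc n)
      then obtain z where z: "z \<in> Q" "w ^ n * x = v ^ n * z" by blast
      then obtain z' where z': "z * w = v * z'" using Q(3) unfolding P_def colon_def dvd_def by blast
      have "w ^ Suc n * x = w * (w ^ n * x)" by simp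
      also have "\<dots> = v ^ n * (z * w)" using z(2) by (simp add: ac_simps)
      also have "\<dots> = v ^ Suc n * z'" using z' by (simp add: ac_simps)
      finally show ?case using stable[OF z(1) z'] by blast
    qed
    then have "v dvd w" using normal_noetherian_dvd[OF noeth normal v(2) Q(2)] dvd_triv_left by metis
    then show False using nw by blast
  qed
  have "v \<in> P" unfolding P_def colon_def by simp
  \<comment> \<open>As \<open>P\<close> is not stable, \<open>w / v\<close> carries some
    \<open>\<pi>\<close> in \<open>P\<close> to an element \<open>z0\<close> outside
    \<open>P\<close>. This \<open>\<pi>\<close> generates \<open>P\<close> after localizing at
    \<open>P\<close>.\<close>
  obtain \<pi> z0 where \<pi>: "\<pi> \<in> P" "\<pi> * w = v * z0" "z0 \<notin> P"
    using not_stable[of v P] \<open>v \<in> P\<close> v(2) by blast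
  have "ideal_height P = 1"
  proof (rule ideal_height_eq_1[OF prime])
    show "P \<noteq> {0}" using \<open>v \<in> P\<close> v(2) by blast
    fix Q assume Q: "is_prime_ideal Q" "Q \<subset> P"
    have Q_mult: "r * x \<in> Q" if "x \<in> Q" for r x using Q(1) that unfolding is_prime_ideal_def is_ideal_def by blast
    have Q_prime: "x \<in> Q \<or> y \<in> Q" if "x * y \<in> Q" for x y using Q(1) that unfolding is_prime_ideal_def by blast
    have "z0 \<notin> Q" using \<pi>(3) Q(2) by blast
    have rel: "x * z0 = y * \<pi>" if "x * w = v * y" for x y
    proof -
      have "v * (x * z0) = x * (\<pi> * w)" using \<pi>(2) by (simp add: ac_simps)
      also have "\<dots> = v * (y * \<pi>)" using that by (simp add: ac_simps)
      finally show ?thesis using v(2) by simp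
    qed
    \<comment> \<open>By \<open>rel\<close>, multiplication by \<open>z0\<close> turns each element
      of \<open>P\<close> into a multiple of \<open>\<pi>\<close>, so \<open>\<pi> \<in> Q\<close>
      would give \<open>P \<subseteq> Q\<close>. Once \<open>\<pi>\<close> is outside,
      \<open>rel\<close> also makes \<open>Q\<close> stable under \<open>w / v\<close>, hence
      zero.\<close>
    have "\<pi> \<notin> Q"
    proof
      assume "\<pi> \<in> Q"
      have "x \<in> Q" if xP: "x \<in> P" for x
      proof -
        obtain y where "x * w = v * y" using xP unfolding P_def colon_def dvd_def by blast
        then have "x * z0 \<in> Q" using rel Q_mult[OF \<open>\<pi> \<in> Q\<close>] by metis
        then show ?thesis using Q_prime \<open>z0 \<notin> Q\<close> by blast
      qed
      then show False using Q(2) by blast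
    qed
    have stable: "z \<in> Q" if "s \<in> Q" "s * w = v * z" for s z
    proof -
      have "z * \<pi> \<in> Q" using rel[OF that(2)] Q_mult[OF that(1), of z0] by (simp add: mult.commute)
      then show ?thesis using Q_prime \<open>\<pi> \<notin> Q\<close> by blast
    qed
    have "x = 0" if "x \<in> Q" for x
      using not_stable[OF that] stable Q(2) by blast
    then show "Q = {0}" using Q(1) unfolding is_prime_ideal_def is_ideal_def by blast
  qed
  then have "P \<in> height_one_homogeneous_primes B"
    unfolding height_one_homogeneous_primes_def using prime homogeneous_idealI[OF P_ideal cpP] by blast
  then obtain s where "s \<notin> P" "v dvd s * u" using loc by blast
  then show False using uw unfolding colon_def by blast
qed

end

section \<open>Degrees with respect to a locally nilpotent derivation\<close>

text \<open>Applied both to Veronese subrings and, with \<open>A = UNIV\<close>, to the whole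
  ring.\<close>

locale derivation_of_subring =
  fixes A :: "'b::idom set" and D :: "'b \<Rightarrow> 'b"
  assumes subring: "is_subring A" and derivation: "derivation_on A D"
begin

lemma D_in: "x \<in> A \<Longrightarrow> D x \<in> A"
  and D_add: "x \<in> A \<Longrightarrow> y \<in> A \<Longrightarrow> D (x + y) = D x + D y"
  and D_mult: "x \<in> A \<Longrightarrow> y \<in> A \<Longrightarrow> D (x * y) = D x * y + x * D y"
  using derivation unfolding derivation_on_def by blast+

lemmas A_intros = subring_0[OF subring] subring_1[OF subring] subring_add[OF subring]
  subring_diff[OF subring] subring_mult[OF subring] subring_sum[OF subring] subring_power[OF subring]
  subring_of_nat[OF subring]

lemma D_0: "D 0 = 0"
  using D_add[OF subring_0[OF subring] subring_0[OF subring]] by (metis add_cancel_right_right)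

lemma D_1: "D 1 = 0"
  using D_mult[OF subring_1[OF subring] subring_1[OF subring]]
  by (metis add_cancel_right_right mult.left_neutral mult.right_neutral)

lemma D_diff: "x \<in> A \<Longrightarrow> y \<in> A \<Longrightarrow> D (x - y) = D x - D y"
  using D_add[of "x - y" y] A_intros by simp

lemma D_sum: "(\<And>i. i \<in> I \<Longrightarrow> f i \<in> A) \<Longrightarrow> D (sum f I) = (\<Sum>i\<in>I. D (f i))"
  by (induction I rule: infinite_finite_induct) (auto simp: D_0 D_add A_intros)

lemma D_of_nat: "D (of_nat n) = 0"
  by (induction n) (auto simp: D_0 D_1 D_add A_intros)

lemma D_power: "x \<in> A \<Longrightarrow> D (x ^ n) = of_nat n * x ^ (n - 1) * D x"
proof (induction n)
  case (Suc n)
  have "D (x ^ Suc n) = D x * x ^ n + x * (of_nat n * x ^ (n - 1) * D x)"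
    using Suc by (simp add: D_mult A_intros)
  also have "x * (of_nat n * x ^ (n - 1) * D x) = of_nat n * x ^ n * D x"
    by (cases n) (simp_all add: ac_simps)
  finally show ?case by (simp add: algebra_simps)
qed (simp add: D_1)

lemma iter_in: "x \<in> A \<Longrightarrow> (D ^^ n) x \<in> A"
  by (induction n) (auto simp: D_in)

lemma iter_0: "(D ^^ n) 0 = 0"
  by (induction n) (auto simp: D_0)

lemma iter_add: "x \<in> A \<Longrightarrow> y \<in> A \<Longrightarrow> (D ^^ n) (x + y) = (D ^^ n) x + (D ^^ n) y"
  by (induction n) (auto simp: D_add iter_in)

lemma iter_diff: "x \<in> A \<Longrightarrow> y \<in> A \<Longrightarrow> (D ^^ n) (x - y) = (D ^^ n) x - (D ^^ n) y"
  by (induction n) (auto simp: D_diff iter_in)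

lemma iter_const_mult: "c \<in> A \<Longrightarrow> D c = 0 \<Longrightarrow> x \<in> A \<Longrightarrow> (D ^^ n) (c * x) = c * (D ^^ n) x"
  by (induction n) (auto simp: D_mult iter_in)

lemma iter_zero_mono: "(D ^^ m) x = 0 \<Longrightarrow> m \<le> n \<Longrightarrow> (D ^^ n) x = 0"
  using funpow_add[of "n - m" m D] iter_0[of "n - m"] by (simp add: fun_eq_iff)

text \<open>In the Leibniz expansion every other term contains a vanishing iterate. The induction
  splits off one \<open>D\<close>, and Pascal's rule adds the two binomial coefficients.\<close>

lemma iter_mult_top:
  assumes "x \<in> A" "y \<in> A" "(D ^^ Suc m) x = 0" "(D ^^ Suc n) y = 0"
  shows "(D ^^ (m + n)) (x * y) = of_nat ((m + n) choose m) * ((D ^^ m) x * (D ^^ n) y)"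
  using assms
proof (induction "m + n" arbitrary: m n x y)
  case (Suc k)
  show ?case
  proof (cases "m = 0 \<or> n = 0")
    case True
    then show ?thesis
      using Suc.prems iter_const_mult[of x y n] iter_const_mult[of y x m] by (auto simp: mult.commute)
  next
    case False
    then obtain m' n' where mn: "m = Suc m'" "n = Suc n'" by (meson not0_implies_Suc)
    have 1: "(D ^^ (m' + n)) (D x * y) = of_nat ((m' + n) choose m') * ((D ^^ m') (D x) * (D ^^ n) y)"
      using Suc.hyps(2) Suc.prems mn by (intro Suc.hyps(1)) (simp_all add: D_in funpow_swap1)
    have 2: "(D ^^ (m + n')) (x * D y) = of_nat ((m + n') choose m) * ((D ^^ m) x * (D ^^ n') (D y))"
      using Suc.hyps(2) Suc.prems mn by (intro Suc.hyps(1)) (simp_all add: D_in funpow_swap1)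
    have "(D ^^ (m + n)) (x * y) = (D ^^ (m' + n)) (D (x * y))"
      using mn by (simp add: funpow_swap1)
    also have "\<dots> = (D ^^ (m' + n)) (D x * y) + (D ^^ (m + n')) (x * D y)"
      using Suc.prems(1,2) mn iter_add[of "D x * y" "x * D y" "m' + n"] by (simp add: D_mult A_intros D_in)
    also have "\<dots> = (of_nat ((m' + n) choose m') + of_nat ((m' + n) choose m)) * ((D ^^ m) x * (D ^^ n) y)"
      unfolding 1 2 using mn by (simp add: funpow_swap1 algebra_simps)
    finally show ?thesis using mn by simp
  qed
qed auto

text \<open>A relation rather than a function, so that 0 has no degree and no default value
  enters.\<close>

definition deg :: "nat \<Rightarrow> 'b \<Rightarrow> bool" where
  "deg n x \<longleftrightarrow> x \<in> A \<and> (D ^^ n) x \<noteq> 0 \<and> (D ^^ Suc n) x = 0"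

lemma deg_unique: "deg m x \<Longrightarrow> deg n x \<Longrightarrow> m = n"
  unfolding deg_def using iter_zero_mono by (metis Suc_leI linorder_neqE_nat)

lemma deg_0_iff: "deg 0 x \<longleftrightarrow> x \<in> A \<and> x \<noteq> 0 \<and> D x = 0"
  unfolding deg_def by simp

lemma deg_D: "deg (Suc n) x \<Longrightarrow> deg n (D x)"
  unfolding deg_def by (simp add: D_in funpow_swap1)

end

locale lnd = derivation_of_subring +
  assumes nilpotent: "locally_nilpotent_on A D"
    and char_0: "\<And>n. n > 0 \<Longrightarrow> of_nat n \<noteq> (0 :: 'a)"
begin

lemma deg_exists:
  assumes "x \<in> A" "x \<noteq> 0" shows "\<exists>n. deg n x"
proof -
  have "\<exists>n. (D ^^ n) x = 0" using nilpotent assms(1) unfolding locally_nilpotent_on_def by blast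
  moreover have "(D ^^ 0) x \<noteq> 0" using assms(2) by simp
  ultimately obtain n where "(D ^^ Suc n) x = 0" "(D ^^ n) x \<noteq> 0"
    using exists_least_iff[of "\<lambda>n. (D ^^ n) x = 0"] by (metis lessI not0_implies_Suc)
  then show ?thesis unfolding deg_def using assms(1) by blast
qed

text \<open>The top term is a binomial coefficient times two nonzero kernel elements, which is
  nonzero in a domain of characteristic 0.\<close>

lemma deg_mult: "deg m x \<Longrightarrow> deg n y \<Longrightarrow> deg (m + n) (x * y)"
proof -
  assume xy: "deg m x" "deg n y"
  then have top: "(D ^^ (m + n)) (x * y) = of_nat ((m + n) choose m) * ((D ^^ m) x * (D ^^ n) y)"
    using iter_mult_top unfolding deg_def by blast
  have "D ((D ^^ (m + n)) (x * y)) = 0"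
    using xy unfolding top deg_def by (simp add: D_mult D_of_nat iter_in A_intros)
  moreover have "(D ^^ (m + n)) (x * y) \<noteq> 0"
    using xy char_0[of "(m + n) choose m"] unfolding top deg_def by simp
  ultimately show ?thesis using xy unfolding deg_def by (simp add: A_intros)
qed

lemma deg_power: "deg n x \<Longrightarrow> deg (k * n) (x ^ k)"
  by (induction k) (use deg_mult[of n x] in \<open>auto simp: deg_0_iff D_1 A_intros\<close>)

text \<open>The degrees of a unit and its inverse add up to the degree 0 of 1.\<close>

lemma D_unit:
  assumes "u \<in> A" "v \<in> A" "u * v = 1" shows "D u = 0"
proof -
  have "u \<noteq> 0" "v \<noteq> 0" using assms by auto
  then obtain m n where mn: "deg m u" "deg n v" using deg_exists assms by blast
  have "deg 0 (1 :: 'a)" by (simp add: deg_0_iff D_1 A_intros)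
  then have "m + n = 0" using deg_mult[OF mn] deg_unique assms(3) by metis
  then show ?thesis using mn(1) by (simp add: deg_0_iff)
qed

end

section \<open>The top component of a derivation\<close>

context graded_domain
begin

definition below :: "int \<Rightarrow> 'b \<Rightarrow> bool" where
  "below m x \<longleftrightarrow> (\<forall>j>m. cp x j = 0)"

lemma below_0: "below m 0"
  by (simp add: below_def cp_0)

lemma below_add: "below m x \<Longrightarrow> below m y \<Longrightarrow> below m (x + y)"
  by (simp add: below_def cp_add)

lemma below_diff: "below m x \<Longrightarrow> below m y \<Longrightarrow> below m (x - y)"
  by (simp add: below_def cp_diff)

lemma below_sum: "(\<And>i. i \<in> I \<Longrightarrow> below m (f i)) \<Longrightarrow> below m (sum f I)"
  by (simp add: below_def cp_sum)

lemma below_mono: "below m x \<Longrightarrow> m \<le> n \<Longrightarrow> below n x"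
  by (simp add: below_def)

lemma below_hom: "x \<in> B p \<Longrightarrow> below p x"
  by (simp add: below_def cp_hom)

lemma below_mult:
  assumes "below m x" "below n y" shows "below (m + n) (x * y)"
  unfolding below_def cp_mult
proof (intro allI impI sum.neutral ballI)
  fix k j :: int assume "m + n < k"
  then have "j > m \<or> k - j > n" by linarith
  then show "cp x j * cp y (k - j) = 0" using assms unfolding below_def by auto
qed

lemma below_cancel:
  assumes "x \<in> B p" "x \<noteq> 0" "below (p + q) (x * y)" shows "below q y"
  unfolding below_def
proof (intro allI impI)
  fix j assume "q < j"
  then have "cp (x * y) (p + j) = 0" using assms(3) unfolding below_def by simp
  then show "cp y j = 0" using cp_hom_mult[OF assms(1), of y "p + j"] assms(2) by simp
qed

lemma hom_cancel:
  assumes "x \<in> B p" "x \<noteq> 0" "x * y \<in> B (p + q)" shows "y \<in> B q"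
  unfolding hom_iff
proof (intro allI impI)
  fix j assume "j \<noteq> q"
  then have "cp (x * y) (p + j) = 0" using cp_hom[OF assms(3)] by simp
  then show "cp y j = 0" using cp_hom_mult[OF assms(1), of y "p + j"] assms(2) by simp
qed

lemma exists_below: "\<exists>m. below m x"
proof -
  have "below (\<Sum>i\<in>supp x. \<bar>i\<bar>) x"
    unfolding below_def
  proof (intro allI impI)
    fix j assume j: "(\<Sum>i\<in>supp x. \<bar>i\<bar>) < j"
    show "cp x j = 0"
    proof (rule ccontr)
      assume "cp x j \<noteq> 0"
      then have "\<bar>j\<bar> \<le> (\<Sum>i\<in>supp x. \<bar>i\<bar>)" by (intro member_le_sum finite_supp) auto
      then show False using j by linarith
    qed
  qed
  then show ?thesis ..
qed

text \<open>Additive extension of maps given on the components. They are indexed by the degree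
  because the top component of a derivation depends on it.\<close>

definition extend_hom :: "(int \<Rightarrow> 'b \<Rightarrow> 'b) \<Rightarrow> 'b \<Rightarrow> 'b" where
  "extend_hom g b = (\<Sum>i\<in>supp b. g i (cp b i))"

lemma extend_hom_hom:
  assumes "b \<in> B i" "g i 0 = 0" shows "extend_hom g b = g i b"
proof (cases "b = 0")
  case False
  then have "supp b = {i}" using cp_hom[OF assms(1)] by auto
  then show ?thesis unfolding extend_hom_def using cp_hom[OF assms(1)] by simp
qed (simp add: extend_hom_def cp_0 assms)

lemma extend_hom_superset:
  assumes "finite I" "supp x \<subseteq> I" "\<And>i. i \<in> I \<Longrightarrow> g i 0 = 0"
  shows "extend_hom g x = (\<Sum>i\<in>I. g i (cp x i))"
  unfolding extend_hom_def by (rule sum.mono_neutral_left) (use assms in auto)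

lemma extend_hom_add:
  assumes g: "\<And>i x y. int d dvd i \<Longrightarrow> x \<in> B i \<Longrightarrow> y \<in> B i \<Longrightarrow> g i (x + y) = g i x + g i y"
    and xy: "x \<in> veronese d B" "y \<in> veronese d B"
  shows "extend_hom g (x + y) = extend_hom g x + extend_hom g y"
proof -
  let ?I = "supp x \<union> supp y"
  have dvd: "int d dvd i" if "i \<in> ?I" for i using that xy unfolding veronese_iff by auto
  then have g0: "g i 0 = 0" if "i \<in> ?I" for i
    using g[of i 0 0] that hom_0 by (metis add_0_right add_cancel_right_right)
  have "supp (x + y) \<subseteq> ?I" by (auto simp: cp_add)
  then have "extend_hom g (x + y) = (\<Sum>i\<in>?I. g i (cp (x + y) i))"
    by (intro extend_hom_superset) (auto simp: finite_supp g0)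
  also have "\<dots> = (\<Sum>i\<in>?I. g i (cp x i)) + (\<Sum>i\<in>?I. g i (cp y i))"
    unfolding sum.distrib[symmetric] cp_add by (rule sum.cong) (auto simp: g dvd cp_in)
  also have "\<dots> = extend_hom g x + extend_hom g y"
    by (subst (1 2) extend_hom_superset[where I = ?I]) (auto simp: finite_supp g0)
  finally show ?thesis .
qed

lemma additive_sum:
  assumes V: "\<And>x y. x \<in> veronese d B \<Longrightarrow> y \<in> veronese d B \<Longrightarrow> E (x + y) = E x + (E y :: 'b)"
    and f: "\<And>i. i \<in> I \<Longrightarrow> f i \<in> veronese d B"
  shows "E (sum f I) = (\<Sum>i\<in>I. E (f i))"
proof -
  have "E 0 = 0" using V[of 0 0] subring_0[OF is_subring_veronese] by (metis add_0_right add_cancel_right_right)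
  then show ?thesis
    using f by (induction I rule: infinite_finite_induct)
      (auto simp: V subring_sum[OF is_subring_veronese])
qed

text \<open>Both sides of the product rule are biadditive, so each factor can be split into
  components, one factor at a time.\<close>

lemma derivation_onI_homogeneous:
  assumes in_V: "\<And>x. x \<in> veronese d B \<Longrightarrow> E x \<in> veronese d B"
    and add: "\<And>x y. x \<in> veronese d B \<Longrightarrow> y \<in> veronese d B \<Longrightarrow> E (x + y) = E x + E y"
    and mult: "\<And>i j x y. int d dvd i \<Longrightarrow> int d dvd j \<Longrightarrow> x \<in> B i \<Longrightarrow> y \<in> B j \<Longrightarrow> E (x * y) = E x * y + x * E y"
  shows "derivation_on (veronese d B) E"
proof -
  note V = subring_mult[OF is_subring_veronese]
  have mult': "E (x * y) = E x * y + x * E y" if x: "x \<in> veronese d B" and y: "y \<in> B j" "int d dvd j" for x y j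
  proof -
    have yV: "y \<in> veronese d B" using hom_in_veronese y .
    have "E (x * y) = E (\<Sum>i\<in>supp x. cp x i * y)" by (simp add: sum_distrib_right[symmetric] sum_cp)
    also have "\<dots> = (\<Sum>i\<in>supp x. E (cp x i * y))"
      by (rule additive_sum[OF add]) (auto intro: V cp_in_veronese x yV)
    also have "\<dots> = (\<Sum>i\<in>supp x. E (cp x i) * y + cp x i * E y)"
      by (rule sum.cong[OF refl mult[OF _ y(2) cp_in y(1)]]) (use x in \<open>simp add: veronese_iff\<close>)
    also have "\<dots> = (\<Sum>i\<in>supp x. E (cp x i)) * y + x * E y"
      by (simp add: sum.distrib sum_distrib_right[symmetric] sum_cp)
    also have "(\<Sum>i\<in>supp x. E (cp x i)) = E (\<Sum>i\<in>supp x. cp x i)"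
      by (rule additive_sum[OF add, symmetric]) (auto intro: cp_in_veronese x)
    finally show ?thesis by (simp add: sum_cp)
  qed
  have "E (x * y) = E x * y + x * E y" if x: "x \<in> veronese d B" and y: "y \<in> veronese d B" for x y
  proof -
    have "E (x * y) = E (\<Sum>i\<in>supp y. x * cp y i)" by (simp add: sum_distrib_left[symmetric] sum_cp)
    also have "\<dots> = (\<Sum>i\<in>supp y. E (x * cp y i))"
      by (rule additive_sum[OF add]) (auto intro: V cp_in_veronese x y)
    also have "\<dots> = (\<Sum>i\<in>supp y. E x * cp y i + x * E (cp y i))"
      by (rule sum.cong[OF refl mult'[OF x cp_in]]) (use y in \<open>simp add: veronese_iff\<close>)
    also have "\<dots> = E x * y + x * (\<Sum>i\<in>supp y. E (cp y i))"
      by (simp add: sum.distrib sum_distrib_left[symmetric] sum_cp)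
    also have "(\<Sum>i\<in>supp y. E (cp y i)) = E (\<Sum>i\<in>supp y. cp y i)"
      by (rule additive_sum[OF add, symmetric]) (auto intro: cp_in_veronese y)
    finally show ?thesis by (simp add: sum_cp)
  qed
  then show ?thesis unfolding derivation_on_def using in_V add by blast
qed

text \<open>An element has finitely many components, so one exponent kills them all.\<close>

lemma locally_nilpotent_onI_homogeneous:
  assumes der: "derivation_on (veronese d B) E"
    and nil: "\<And>i b. int d dvd i \<Longrightarrow> b \<in> B i \<Longrightarrow> \<exists>n. (E ^^ n) b = 0"
  shows "locally_nilpotent_on (veronese d B) E"
  unfolding locally_nilpotent_on_def
proof
  interpret derivation_of_subring "veronese d B" E
    using der is_subring_veronese by unfold_locales
  fix b assume b: "b \<in> veronese d B"
  have "\<exists>n. (E ^^ n) (cp b i) = 0" if "i \<in> supp b" for i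
    by (rule nil[OF _ cp_in]) (use that b in \<open>simp add: veronese_iff\<close>)
  then obtain n where n: "\<And>i. i \<in> supp b \<Longrightarrow> (E ^^ n i) (cp b i) = 0" by metis
  define m where "m = Suc (\<Sum>i\<in>supp b. n i)"
  have "(E ^^ m) (cp b i) = 0" if i: "i \<in> supp b" for i
  proof (rule iter_zero_mono[OF n[OF i]])
    have "n i \<le> (\<Sum>i\<in>supp b. n i)" by (rule member_le_sum) (use i in \<open>auto simp: finite_supp\<close>)
    then show "n i \<le> m" unfolding m_def by simp
  qed
  moreover have "(E ^^ m) (\<Sum>i\<in>supp b. cp b i) = (\<Sum>i\<in>supp b. (E ^^ m) (cp b i))"
    by (rule additive_sum[OF iter_add]) (auto intro: cp_in_veronese b)
  ultimately have "(E ^^ m) b = 0" by (simp add: sum_cp)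
  then show "\<exists>n>0. (E ^^ n) b = 0" unfolding m_def by blast
qed

end

section \<open>Bounding the degree shift of a derivation of a Veronese subring\<close>

locale veronese_lnd = graded_domain B + lnd "veronese d B" D
  for B :: "int \<Rightarrow> 'b::idom set" and d :: nat and D +
  assumes d_pos: "d > 0"
begin

abbreviation "V \<equiv> veronese d B"

lemma power_in_V: "b \<in> B i \<Longrightarrow> b ^ d \<in> V"
  by (rule hom_in_veronese[OF hom_power]) auto

text \<open>Computes \<open>D ((s * b) ^ d)\<close> twice: as the power of \<open>s * b\<close>,
  which lies in \<open>V\<close>, and as the product of \<open>s ^ d\<close> and
  \<open>b ^ d\<close>. It gives access to elements \<open>b\<close> outside \<open>V\<close>, on
  which \<open>D\<close> itself is not meaningful.\<close>

lemma D_power_mult: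
  assumes "s \<in> B j" "b \<in> B i" "int d dvd j + i"
  shows "s ^ d * D (b ^ d) = of_nat d * (s ^ (d - 1) * b ^ (d - 1)) * D (s * b) - D (s ^ d) * b ^ d"
proof -
  have sb: "s * b \<in> V" using hom_in_veronese[OF hom_mult] assms by blast
  have "D ((s * b) ^ d) = D (s ^ d) * b ^ d + s ^ d * D (b ^ d)"
    using assms by (simp add: power_mult_distrib D_mult power_in_V)
  moreover have "D ((s * b) ^ d) = of_nat d * (s ^ (d - 1) * b ^ (d - 1)) * D (s * b)"
    unfolding D_power[OF sb] by (simp add: power_mult_distrib)
  ultimately show ?thesis by (simp add: algebra_simps)
qed

text \<open>Since formally \<open>D (b ^ d) = d b ^ (d - 1) D b\<close>, this says that the
  extension of \<open>D\<close> to fractions raises the degree of \<open>b\<close> by at most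
  \<open>N\<close>.\<close>

definition bounded :: "int \<Rightarrow> int \<Rightarrow> 'b \<Rightarrow> bool" where
  "bounded N i b \<longleftrightarrow> b \<in> B i \<and> below (int d * i + N) (D (b ^ d))"

lemma bounded_0: "bounded N i 0"
  unfolding bounded_def using d_pos by (simp add: hom_0 D_0 below_0 power_0_left)

lemma bounded_mult:
  assumes "bounded N i b" "bounded N j c" shows "bounded N (i + j) (b * c)"
proof -
  have bc: "b \<in> B i" "c \<in> B j" using assms unfolding bounded_def by auto
  have "below (int d * i + N + int d * j) (D (b ^ d) * c ^ d)"
    "below (int d * i + (int d * j + N)) (b ^ d * D (c ^ d))"
    using assms below_mult[OF _ below_hom[OF hom_power[OF bc(2)]]] below_mult[OF below_hom[OF hom_power[OF bc(1)]]]
    unfolding bounded_def by blast+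
  then have "below (int d * (i + j) + N) (D ((b * c) ^ d))"
    using bc by (simp add: power_mult_distrib D_mult power_in_V below_add algebra_simps)
  then show ?thesis using hom_mult[OF bc] unfolding bounded_def by simp
qed

lemma bounded_1: "bounded N 0 1"
  unfolding bounded_def using hom_1 by (simp add: D_1 below_0)

lemma bounded_power:
  assumes "bounded N i b" shows "bounded N (int k * i) (b ^ k)"
proof (induction k)
  case 0
  then show ?case using bounded_1 by simp
next
  case (Suc k)
  then show ?case using bounded_mult[OF assms Suc] by (simp add: algebra_simps)
qed

text \<open>\<open>D\<close> is additive only on \<open>V\<close>. Multiplying by a homogeneous
  \<open>s\<close> moves \<open>b\<close>, \<open>c\<close> and \<open>b + c\<close> into
  \<open>V\<close>; the bound is proved there and \<open>s\<close> is cancelled.\<close>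

lemma bounded_add:
  assumes b: "bounded N i b" and c: "bounded N i c" shows "bounded N i (b + c)"
proof (cases "b = 0 \<or> c = 0")
  case False
  obtain e where e: "d = Suc e" using d_pos by (cases d) auto
  \<comment> \<open>Of degree \<open>(d - 1) i\<close>, so \<open>s * x\<close> has degree
    \<open>d i\<close> for every \<open>x\<close> in \<open>B i\<close>.\<close>
  define s where "s = b ^ e"
  have s: "bounded N (int e * i) s" unfolding s_def by (rule bounded_power[OF b])
  have hom: "b \<in> B i" "c \<in> B i" "s \<in> B (int e * i)" using b c s unfolding bounded_def by auto
  have sV: "s * x \<in> V" if "x \<in> B i" for x
  proof (rule hom_in_veronese[OF hom_mult[OF hom(3) that]])
    have "int e * i + i = int d * i" by (simp add: e algebra_simps)
    then show "int d dvd int e * i + i" by simp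
  qed
  have below_D: "below (int d * i + N) (D (s * x))" if x: "bounded N i x" "x \<noteq> 0" for x
  proof -
    have x_hom: "x \<in> B i" using x unfolding bounded_def by simp
    have "of_nat d * (s * x) ^ e \<in> B (int e * (int e * i + i))"
      by (intro hom_of_nat_mult hom_power hom_mult hom x_hom)
    moreover have "of_nat d * (s * x) ^ e \<noteq> 0"
      using char_0[OF d_pos] x False unfolding s_def by simp
    moreover have "below (int e * (int e * i + i) + (int d * i + N)) (of_nat d * (s * x) ^ e * D (s * x))"
    proof -
      have "of_nat d * (s * x) ^ e * D (s * x) = D ((s * x) ^ d)"
        unfolding D_power[OF sV[OF x_hom]] by (simp add: e)
      moreover have "int e * (int e * i + i) + (int d * i + N) = int d * (int e * i + i) + N"
        by (simp add: e algebra_simps)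
      ultimately show ?thesis using bounded_mult[OF s x(1)] unfolding bounded_def by metis
    qed
    ultimately show ?thesis by (rule below_cancel)
  qed
  have "s * (b + c) = s * b + s * c" by (simp add: algebra_simps)
  then have D_s: "below (int d * i + N) (D (s * (b + c)))"
    using below_D b c False hom by (simp add: D_add sV below_add)
  have below1: "below (int e * (int e * i) + int e * i + (int d * i + N))
      (of_nat d * (s ^ e * (b + c) ^ e) * D (s * (b + c)))"
    by (intro below_mult below_hom hom_of_nat_mult hom_mult hom_power hom hom_add D_s)
  have below2: "below (int d * (int e * i) + N + int d * i) (D (s ^ d) * (b + c) ^ d)"
    by (rule below_mult[OF _ below_hom[OF hom_power[OF hom_add[OF hom(1,2)]]]]) (use s in \<open>simp add: bounded_def\<close>)
  \<comment> \<open>Expresses the wanted derivative, up to the factor \<open>s ^ d\<close>, by two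
    terms bounded in the same degree.\<close>
  have eq: "s ^ d * D ((b + c) ^ d) = of_nat d * (s ^ e * (b + c) ^ e) * D (s * (b + c)) - D (s ^ d) * (b + c) ^ d"
  proof -
    have "int e * i + i = int d * i" by (simp add: e algebra_simps)
    then have "int d dvd int e * i + i" by simp
    from D_power_mult[OF hom(3) hom_add[OF hom(1,2)] this] show ?thesis by (simp only: e diff_Suc_1)
  qed
  have "below (int d * (int e * i) + (int d * i + N)) (s ^ d * D ((b + c) ^ d))"
  proof -
    have "int e * (int e * i) + int e * i + (int d * i + N) = int d * (int e * i) + (int d * i + N)"
      "int d * (int e * i) + N + int d * i = int d * (int e * i) + (int d * i + N)"
      by (simp_all add: e algebra_simps)
    then show ?thesis using below_diff below1 below2 unfolding eq by metis
  qed
  then have "below (int d * i + N) (D ((b + c) ^ d))"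
    by (rule below_cancel[OF hom_power[OF hom(3)], rotated]) (use False in \<open>simp add: s_def\<close>)
  then show ?thesis unfolding bounded_def using hom_add hom by blast
qed (use b c in auto)

lemma is_subring_bounded: "is_subring {b. \<forall>i. bounded N i (cp b i)}"
proof -
  have sum: "bounded N i (sum f J)" if "\<And>j. j \<in> J \<Longrightarrow> bounded N i (f j)" for i and f :: "int \<Rightarrow> 'b" and J
    using that by (induction J rule: infinite_finite_induct) (auto intro: bounded_0 bounded_add)
  \<comment> \<open>\<open>D\<close> kills \<open>(- 1) ^ d\<close>, which is 1 or - 1, so
    multiplication by - 1 preserves the bound.\<close>
  have "D (0 - 1) = 0" by (subst D_diff) (auto simp: D_0 D_1 A_intros)
  then have "D ((- 1) ^ d) = 0" by (cases "even d") (auto simp: D_1)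
  then have "bounded N 0 (- 1)"
    unfolding bounded_def using hom_diff[OF hom_0 hom_1] by (simp add: below_0)
  then have neg: "bounded N i (- c)" if "bounded N i c" for i c
    using bounded_mult[OF _ that, of 0 "- 1"] by simp
  have diff: "bounded N i (b - c)" if "bounded N i b" "bounded N i c" for i b c
    using bounded_add[OF that(1) neg[OF that(2)]] by simp
  have prod: "bounded N k (cp x j * cp y (k - j))" if "\<forall>i. bounded N i (cp x i)" "\<forall>i. bounded N i (cp y i)" for x y j k
    using bounded_mult[of N j "cp x j" "k - j" "cp y (k - j)"] that by simp
  show ?thesis
    unfolding is_subring_def
    by (auto simp: cp_hom[OF hom_1] cp_diff cp_mult bounded_1 bounded_0 intro!: diff sum prod)
qed

lemma exists_bounded: "\<exists>N. \<forall>i. bounded N i (cp b i)"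
proof -
  have "\<forall>i. \<exists>N. below N (D (cp b i ^ d))" using exists_below by blast
  then obtain n where n: "\<And>i. below (n i) (D (cp b i ^ d))" by metis
  define N where "N = (\<Sum>i\<in>supp b. \<bar>n i - int d * i\<bar>)"
  have "bounded N i (cp b i)" for i
  proof (cases "cp b i = 0")
    case False
    then have "\<bar>n i - int d * i\<bar> \<le> N" unfolding N_def by (intro member_le_sum finite_supp) auto
    then have "n i \<le> int d * i + N" by linarith
    then show ?thesis unfolding bounded_def using below_mono[OF n] cp_in by blast
  qed (simp add: bounded_0)
  then show ?thesis by blast
qed

lemma bounded_mono: "bounded M i b \<Longrightarrow> M \<le> N \<Longrightarrow> bounded N i b"
  unfolding bounded_def by (auto elim: below_mono)

text \<open>The bound on \<open>D (b ^ d)\<close> makes sense for all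
  homogeneous \<open>b\<close>, and the elements satisfying it form a subring, so that it has to be checked
  only on generators of \<open>B\<close>; no generators of the Veronese subring are needed.\<close>

lemma degree_bound:
  fixes \<iota> :: "'k::field \<Rightarrow> 'b"
  assumes affine: "affine_algebra \<iota>"
  shows "\<exists>N. \<forall>i b. b \<in> B i \<longrightarrow> int d dvd i \<longrightarrow> below (i + N) (D b)"
proof -
  obtain S where S: "finite S" "is_subring hull (range \<iota> \<union> S) = UNIV" and \<iota>: "algebra_map \<iota>"
    using affine unfolding affine_algebra_def by blast
  have "\<exists>N. \<forall>b\<in>S. \<forall>i. bounded N i (cp b i)" using S(1)
  proof induction
    case (insert x S)
    then obtain M where M: "\<forall>b\<in>S. \<forall>i. bounded M i (cp b i)" by blast
    obtain N where N: "\<forall>i. bounded N i (cp x i)" using exists_bounded by blast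
    have "\<forall>b\<in>insert x S. \<forall>i. bounded (max M N) i (cp b i)"
      using M N bounded_mono[of M _ _ "max M N"] bounded_mono[of N _ _ "max M N"] by auto
    then show ?case by blast
  qed auto
  then obtain N where N: "\<forall>b\<in>S. \<forall>i. bounded N i (cp b i)" by blast
  \<comment> \<open>Nonzero scalars are units of degree 0, so their \<open>d\<close>-th powers are
    units of \<open>V\<close> and killed by \<open>D\<close>.\<close>
  have "bounded N i (cp (\<iota> c) i)" for c i
  proof (cases "c = 0 \<or> i \<noteq> 0")
    case True
    then show ?thesis using cp_hom[OF algebra_map_hom_0[OF \<iota>]] algebra_map_0[OF \<iota>] cp_0 bounded_0 by auto
  next
    case False
    have hom: "\<iota> x \<in> B 0" for x by (rule algebra_map_hom_0[OF \<iota>])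
    have "\<iota> c ^ d * \<iota> (inverse c) ^ d = 1"
      using algebra_map_inverse[OF \<iota>, of c] False by (simp add: power_mult_distrib[symmetric])
    then have "D (\<iota> c ^ d) = 0" by (rule D_unit[OF power_in_V[OF hom] power_in_V[OF hom]])
    then show ?thesis using False hom cp_hom[OF hom] by (simp add: bounded_def below_0)
  qed
  then have "is_subring hull (range \<iota> \<union> S) \<subseteq> {b. \<forall>i. bounded N i (cp b i)}"
    using N by (intro hull_minimal is_subring_bounded) auto
  then have all: "bounded N i (cp b i)" for b i using S(2) by blast
  \<comment> \<open>For \<open>b\<close> in \<open>V\<close> the factor \<open>d b ^ (d - 1)\<close>
    can be cancelled from \<open>D (b ^ d)\<close>.\<close>
  have "below (i + N) (D b)" if b: "b \<in> B i" "int d dvd i" for i b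
  proof (cases "b = 0")
    case False
    have "below (int d * i + N) (of_nat d * b ^ (d - 1) * D b)"
      using all[of i b] cp_hom[OF b(1)] D_power[OF hom_in_veronese[OF b], of d] by (simp add: bounded_def)
    moreover have "int d * i + N = int (d - 1) * i + (i + N)"
      using d_pos by (simp add: of_nat_diff algebra_simps)
    ultimately show ?thesis
      using below_cancel[OF hom_of_nat_mult[OF hom_power[OF b(1)]], of d "d - 1" "i + N"] char_0[OF d_pos] False
      by simp
  qed (simp add: D_0 below_0)
  then show ?thesis by blast
qed

text \<open>\<open>E\<close> collects the parts of \<open>D\<close> that shift degrees by the
  largest amount \<open>m\<close> that occurs. Then \<open>(E ^^ n) b\<close> is a component of
  \<open>(D ^^ n) b\<close>, so nilpotency is inherited.\<close>

lemma homogeneous_lnd_exists: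
  fixes \<iota> :: "'k::field \<Rightarrow> 'b"
  assumes affine: "affine_algebra \<iota>" and nz: "\<exists>x\<in>V. D x \<noteq> 0"
  shows "\<exists>E m. derivation_on V E \<and> locally_nilpotent_on V E \<and> (\<exists>x\<in>V. E x \<noteq> 0) \<and> int d dvd m \<and>
    (\<forall>i b. int d dvd i \<longrightarrow> b \<in> B i \<longrightarrow> E b \<in> B (i + m))"
proof -
  obtain N where N: "\<And>i b. b \<in> B i \<Longrightarrow> int d dvd i \<Longrightarrow> below (i + N) (D b)"
    using degree_bound[OF affine] by blast
  define T where "T = {n. \<exists>i b. b \<in> B i \<and> int d dvd i \<and> cp (D b) (i + n) \<noteq> 0}"
  have T_le: "n \<le> N" if "n \<in> T" for n
    using that N unfolding T_def below_def by (force simp: not_le[symmetric])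
  obtain x where x: "x \<in> V" "D x \<noteq> 0" using nz by blast
  have "D x = (\<Sum>i\<in>supp x. D (cp x i))"
    using D_sum[of "supp x" "cp x"] cp_in_veronese[OF x(1)] by (simp add: sum_cp)
  then obtain i where i: "i \<in> supp x" "D (cp x i) \<noteq> 0"
    using x(2) sum.not_neutral_contains_not_neutral by metis
  then obtain j where "cp (D (cp x i)) j \<noteq> 0" using supp_nonempty by blast
  then have "cp (D (cp x i)) (i + (j - i)) \<noteq> 0" by simp
  then have "j - i \<in> T" unfolding T_def using cp_in x(1) i(1) unfolding veronese_iff by blast
  \<comment> \<open>\<open>T\<close>, the set of degree shifts that occur, is nonempty and bounded
    above by \<open>N\<close>; counting down from \<open>N\<close> turns its maximum into a least
    natural number.\<close>
  then have "N - int (nat (N - (j - i))) \<in> T" using T_le by fastforce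
  then obtain k where k: "N - int k \<in> T" and least: "\<And>l. N - int l \<in> T \<Longrightarrow> k \<le> l"
    using exists_least_iff[of "\<lambda>k. N - int k \<in> T"] by (meson not_le)
  define m where "m = N - int k"
  have mT: "m \<in> T" unfolding m_def by (rule k)
  have m_max: "n \<le> m" if "n \<in> T" for n
    using least[of "nat (N - n)"] T_le[OF that] that unfolding m_def by auto
  have bound: "below (i + m) (D b)" if "b \<in> B i" "int d dvd i" for i b
    unfolding below_def
  proof (intro allI impI, rule ccontr)
    fix j assume "i + m < j" "cp (D b) j \<noteq> 0"
    then have "j - i \<in> T" unfolding T_def using that by (intro CollectI exI[of _ i] exI[of _ b]) simp
    then show False using m_max \<open>i + m < j\<close> by fastforce
  qed
  obtain i0 b0 where b0: "b0 \<in> B i0" "int d dvd i0" "cp (D b0) (i0 + m) \<noteq> 0" using mT unfolding T_def by blast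
  have "int d dvd i0 + m" using b0 D_in[OF hom_in_veronese[OF b0(1,2)]] unfolding veronese_iff by blast
  then have dm: "int d dvd m" using b0(2) by (simp add: dvd_add_right_iff)
  define E where "E = extend_hom (\<lambda>i b. cp (D b) (i + m))"
  have E_hom: "E b = cp (D b) (i + m)" if "b \<in> B i" for i b
    unfolding E_def by (rule extend_hom_hom[OF that]) (simp add: D_0 cp_0)
  have E_add: "E (x + y) = E x + E y" if "x \<in> V" "y \<in> V" for x y
    unfolding E_def by (rule extend_hom_add[OF _ that]) (simp add: D_add hom_in_veronese cp_add)
  have E_V: "E x \<in> V" if "x \<in> V" for x
    unfolding E_def extend_hom_def by (intro A_intros cp_in_veronese D_in that)
  have der: "derivation_on V E"
  proof (rule derivation_onI_homogeneous[OF E_V E_add])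
    fix i j x y assume ij: "int d dvd i" "int d dvd j" "x \<in> B i" "y \<in> B j"
    have "E (x * y) = cp (D x * y + x * D y) (i + j + m)"
      using E_hom[OF hom_mult] ij by (simp add: D_mult hom_in_veronese)
    also have "\<dots> = y * cp (D x) (i + m) + x * cp (D y) (j + m)"
      using cp_hom_mult[OF ij(4), of "D x" "i + j + m"] cp_hom_mult[OF ij(3), of "D y" "i + j + m"]
      by (simp add: cp_add mult.commute[of _ y] algebra_simps)
    finally show "E (x * y) = E x * y + x * E y"
      using E_hom ij by (simp add: mult.commute)
  qed
  \<comment> \<open>The top component of \<open>D y\<close> depends only on the top component of
    \<open>y\<close>, since no shift exceeds \<open>m\<close>. This drives the induction in
    \<open>iter\<close>.\<close>
  have top: "below (p + m) (D y) \<and> cp (D y) (p + m) = cp (D (cp y p)) (p + m)" if y: "y \<in> V" "below p y" for y p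
  proof -
    have bd: "below (i + m) (D (cp y i))" for i
    proof (cases "cp y i = 0")
      case False
      then show ?thesis using bound[OF cp_in] y(1) unfolding veronese_iff by blast
    qed (simp add: D_0 below_0)
    have Dy: "D y = (\<Sum>i\<in>supp y. D (cp y i))"
      using D_sum[of "supp y" "cp y"] cp_in_veronese[OF y(1)] by (simp add: sum_cp)
    have supp_le: "i \<le> p" if "i \<in> supp y" for i using that y(2) unfolding below_def by (force simp: not_le[symmetric])
    have 1: "below (p + m) (D y)"
      unfolding Dy by (rule below_sum, rule below_mono[OF bd]) (use supp_le in auto)
    have "cp (D y) (p + m) = (\<Sum>i\<in>supp y. cp (D (cp y i)) (p + m))" unfolding Dy cp_sum ..
    also have "\<dots> = (\<Sum>i\<in>supp y. if i = p then cp (D (cp y p)) (p + m) else 0)"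
    proof (rule sum.cong)
      fix i assume "i \<in> supp y"
      then show "cp (D (cp y i)) (p + m) = (if i = p then cp (D (cp y p)) (p + m) else 0)"
        using supp_le[of i] bd[of i] unfolding below_def by auto
    qed simp
    also have "\<dots> = cp (D (cp y p)) (p + m)"
      by (auto simp: finite_supp D_0 cp_0)
    finally show ?thesis using 1 by blast
  qed
  have iter: "below (i + int n * m) ((D ^^ n) b) \<and> (E ^^ n) b = cp ((D ^^ n) b) (i + int n * m)"
    if b: "b \<in> B i" "int d dvd i" for i b n
  proof (induction n)
    case (Suc n)
    have E_eq: "E (cp ((D ^^ n) b) (i + int n * m)) = cp (D (cp ((D ^^ n) b) (i + int n * m))) (i + int n * m + m)"
      by (rule E_hom[OF cp_in])
    have idx: "i + int (Suc n) * m = i + int n * m + m" by (simp add: algebra_simps)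
    show ?case
      using top[OF iter_in[OF hom_in_veronese[OF b]] conjunct1[OF Suc]] E_eq Suc unfolding idx by simp
  qed (use b in \<open>simp add: below_hom cp_hom\<close>)
  have "locally_nilpotent_on V E"
  proof (rule locally_nilpotent_onI_homogeneous[OF der])
    fix i b assume b: "int d dvd i" "b \<in> B i"
    obtain n where "(D ^^ n) b = 0"
      using nilpotent hom_in_veronese[OF b(2,1)] unfolding locally_nilpotent_on_def by blast
    then have "(E ^^ n) b = 0" using iter[OF b(2,1), of n] cp_0 by simp
    then show "\<exists>n. (E ^^ n) b = 0" ..
  qed
  moreover have "\<exists>x\<in>V. E x \<noteq> 0" using b0 E_hom hom_in_veronese by metis
  moreover have "\<forall>i b. int d dvd i \<longrightarrow> b \<in> B i \<longrightarrow> E b \<in> B (i + m)" using E_hom cp_in by metis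
  ultimately show ?thesis using der dm by blast
qed

end

section \<open>Extending a derivation of a Veronese subring\<close>

context veronese_lnd
begin

text \<open>The unique derivation of the field of fractions extending \<open>D\<close> maps a homogeneous \<open>b\<close>
  to \<open>D (b ^ d) / (d b ^ (d - 1))\<close>. Saturation provides, for each prime \<open>P\<close> of height 1, an
  \<open>s \<notin> P\<close> with \<open>s b\<close> in the Veronese subring, so that this fraction has no pole at \<open>P\<close>.\<close>

lemma extension_exists:
  assumes noeth: "noetherian_subring (UNIV :: 'b set)" and normal: "normal_domain TYPE('b)"
    and sat: "saturated_in_codim_1 B"
    and unit: "\<exists>c. of_nat d * c = (1 :: 'b)"
    and hom_D: "\<And>i b. int d dvd i \<Longrightarrow> b \<in> B i \<Longrightarrow> D b \<in> B (i + m)"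
    and b: "b \<in> B i"
  shows "\<exists>z. of_nat d * b ^ (d - 1) * z = D (b ^ d)"
proof (cases "b = 0")
  case True
  then show ?thesis using d_pos by (intro exI[of _ 0]) (simp add: power_0_left D_0)
next
  case False
  have "b ^ (d - 1) dvd D (b ^ d)"
  proof (rule dvd_if_locally_dvd[OF noeth normal])
    show "b ^ (d - 1) \<in> B (int (d - 1) * i)" by (rule hom_power[OF b])
    show "b ^ (d - 1) \<noteq> 0" using False by simp
    show "D (b ^ d) \<in> B (int d * i + m)" by (rule hom_D[OF _ hom_power[OF b]]) simp
    fix P assume P: "P \<in> height_one_homogeneous_primes B"
    then have prime: "is_prime_ideal P" unfolding height_one_homogeneous_primes_def by blast
    obtain s j where s: "s \<in> B j" "s \<notin> P" "int d dvd j + i"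
      using exists_homogeneous_residue[OF sat P b False d_pos] by blast
    have "s ^ d \<notin> P"
    proof -
      have "s ^ Suc n \<notin> P" for n
        using s(2) prime unfolding is_prime_ideal_def by (induction n) auto
      then show ?thesis using d_pos by (cases d) auto
    qed
    \<comment> \<open>In \<open>D_power_mult\<close>, applicable because \<open>s * b\<close> lies
      in \<open>V\<close>, both terms contain \<open>b ^ (d - 1)\<close>.\<close>
    moreover have "b ^ (d - 1) dvd s ^ d * D (b ^ d)"
    proof -
      have "b ^ d = b ^ (d - 1) * b" using d_pos by (cases d) auto
      then show ?thesis unfolding D_power_mult[OF s(1) b s(3)] by (intro dvd_diff dvd_mult2 dvd_mult) auto
    qed
    ultimately show "\<exists>s. s \<notin> P \<and> b ^ (d - 1) dvd s * D (b ^ d)" by blast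
  qed
  then obtain z where z: "D (b ^ d) = b ^ (d - 1) * z" by blast
  obtain c where c: "of_nat d * c = (1 :: 'b)" using unit by blast
  have "of_nat d * b ^ (d - 1) * (c * z) = (of_nat d * c) * (b ^ (d - 1) * z)" by (simp only: ac_simps)
  also have "\<dots> = D (b ^ d)" unfolding c z by simp
  finally show ?thesis ..
qed

text \<open>The values on homogeneous elements are fixed by their defining equation. The derivation
  rules are verified after multiplying into \<open>V\<close>, and nilpotency by the fall of the
  degree of \<open>b ^ d\<close>.\<close>

lemma extension:
  assumes noeth: "noetherian_subring (UNIV :: 'b set)" and normal: "normal_domain TYPE('b)"
    and sat: "saturated_in_codim_1 B"
    and unit: "\<exists>c. of_nat d * c = (1 :: 'b)"
    and nz: "\<exists>x\<in>V. D x \<noteq> 0"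
    and hom_D: "\<And>i b. int d dvd i \<Longrightarrow> b \<in> B i \<Longrightarrow> D b \<in> B (i + m)"
  shows "\<exists>E. derivation_on UNIV E \<and> locally_nilpotent_on UNIV E \<and> (\<exists>x. E x \<noteq> 0) \<and>
    (\<forall>i b. b \<in> B i \<longrightarrow> E b \<in> B (i + m))"
proof -
  \<comment> \<open>For \<open>b = 0\<close> and \<open>d > 1\<close> every \<open>z\<close> solves
    the equation, so the value 0 is prescribed; for homogeneous \<open>b \<noteq> 0\<close> the
    solution is unique.\<close>
  define g where "g b = (if b = 0 then 0 else SOME z. of_nat d * b ^ (d - 1) * z = D (b ^ d))" for b
  have g0: "g 0 = 0" unfolding g_def by simp
  have g: "of_nat d * b ^ (d - 1) * g b = D (b ^ d)" if "b \<in> B i" for b i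
  proof (cases "b = 0")
    case True
    then show ?thesis using d_pos by (simp add: g0 D_0 power_0_left)
  next
    case False
    then show ?thesis
      using someI_ex[OF extension_exists[OF noeth normal sat unit hom_D that]] unfolding g_def by simp
  qed
  have nz_coeff: "of_nat d * b ^ (d - 1) \<noteq> 0" if "b \<noteq> 0" for b :: 'b
    using that char_0[OF d_pos] by simp
  have g_unique: "z = g b" if "b \<in> B i" "b \<noteq> 0" "of_nat d * b ^ (d - 1) * z = D (b ^ d)" for z b i
    using g[OF that(1)] that(3) nz_coeff[OF that(2)] by (metis mult_left_cancel)
  have g_hom: "g b \<in> B (i + m)" if b: "b \<in> B i" for b i
  proof (cases "b = 0")
    case False
    have "D (b ^ d) \<in> B (int d * i + m)" by (rule hom_D[OF _ hom_power[OF b]]) simp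
    moreover have "int d * i + m = int (d - 1) * i + (i + m)"
      using d_pos by (simp add: of_nat_diff algebra_simps)
    ultimately show ?thesis
      using hom_cancel[OF hom_of_nat_mult[OF hom_power[OF b]] nz_coeff[OF False], of "g b" "i + m"]
      unfolding g[OF b] by simp
  qed (simp add: g0 hom_0)
  \<comment> \<open>For fixed \<open>s\<close> the right side is additive in \<open>b\<close> on
    \<open>B i\<close>, which is the source of \<open>g_add\<close>.\<close>
  have g_local: "s ^ d * (of_nat d * g b) = of_nat d * s ^ (d - 1) * D (s * b) - b * D (s ^ d)"
    if s: "s \<in> B j" "int d dvd j + i" and b: "b \<in> B i" for s b i j
  proof (cases "b = 0")
    case False
    have bd: "b ^ d = b ^ (d - 1) * b" using d_pos by (cases d) auto
    have "b ^ (d - 1) * (s ^ d * (of_nat d * g b)) = s ^ d * (of_nat d * b ^ (d - 1) * g b)"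
      by (simp only: ac_simps)
    also have "\<dots> = of_nat d * (s ^ (d - 1) * b ^ (d - 1)) * D (s * b) - D (s ^ d) * (b ^ (d - 1) * b)"
      unfolding g[OF b] D_power_mult[OF s(1) b s(2)] bd[symmetric] ..
    also have "\<dots> = b ^ (d - 1) * (of_nat d * s ^ (d - 1) * D (s * b) - b * D (s ^ d))"
      by (simp only: right_diff_distrib ac_simps)
    finally show ?thesis using False by simp
  qed (simp add: g0 D_0)
  have g_add: "g (x + y) = g x + g y" if x: "x \<in> B i" and y: "y \<in> B i" for x y i
  proof (cases "x = 0")
    case False
    define s where "s = x ^ (d - 1)"
    have "int (d - 1) * i + i = int d * i" using d_pos by (simp add: of_nat_diff algebra_simps)
    then have s: "s \<in> B (int (d - 1) * i)" "int d dvd int (d - 1) * i + i"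
      using hom_power[OF x] unfolding s_def by auto
    have sV: "s * z \<in> V" if "z \<in> B i" for z by (rule hom_in_veronese[OF hom_mult[OF s(1) that] s(2)])
    have "s ^ d * (of_nat d * g (x + y)) = s ^ d * (of_nat d * g x) + s ^ d * (of_nat d * g y)"
      unfolding g_local[OF s hom_add[OF x y]] g_local[OF s x] g_local[OF s y]
      by (simp add: distrib_left D_add sV x y algebra_simps)
    also have "\<dots> = s ^ d * (of_nat d * (g x + g y))" by (simp add: algebra_simps)
    finally show ?thesis using False char_0[OF d_pos] unfolding s_def by simp
  qed (simp add: g0)
  \<comment> \<open>The right side satisfies the equation that characterizes
    \<open>g (x * y)\<close>.\<close>
  have g_mult: "g (x * y) = g x * y + x * g y" if x: "x \<in> B i" and y: "y \<in> B j" for x y i j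
  proof (cases "x * y = 0")
    case False
    have pd: "z ^ d = z ^ (d - 1) * z" for z :: 'b using d_pos by (cases d) auto
    have "of_nat d * (x * y) ^ (d - 1) * (g x * y + x * g y)
        = (of_nat d * x ^ (d - 1) * g x) * (y ^ (d - 1) * y) + (x ^ (d - 1) * x) * (of_nat d * y ^ (d - 1) * g y)"
      by (simp add: power_mult_distrib algebra_simps)
    also have "\<dots> = D ((x * y) ^ d)"
      unfolding g[OF x] g[OF y] pd[symmetric] by (simp add: power_mult_distrib D_mult[OF power_in_V[OF x] power_in_V[OF y]])
    finally show ?thesis using g_unique[OF hom_mult[OF x y] False] by simp
  qed (auto simp: g0)
  define E where "E = extend_hom (\<lambda>_. g)"
  have E_hom: "E b = g b" if "b \<in> B i" for b i
    unfolding E_def using extend_hom_hom[OF that, of "\<lambda>_. g"] g0 by simp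
  have "derivation_on (veronese 1 B) E"
  proof (rule derivation_onI_homogeneous)
    show "E x \<in> veronese 1 B" for x unfolding veronese_1 by simp
    show "E (x + y) = E x + E y" if "x \<in> veronese 1 B" "y \<in> veronese 1 B" for x y
      unfolding E_def by (rule extend_hom_add[OF g_add that])
    show "E (x * y) = E x * y + x * E y" if "x \<in> B i" "y \<in> B j" for x y i j
      using E_hom hom_mult that g_mult by metis
  qed
  moreover have "\<exists>k. (E ^^ k) b = 0" if b_hom: "b \<in> B i" for b i
  proof (cases "b = 0")
    case False
    \<comment> \<open>The induction runs on the degree of \<open>b ^ d\<close>, as \<open>b\<close>
      may lie outside \<open>V\<close>.\<close>
    then obtain n where "deg n (b ^ d)" using deg_exists[OF power_in_V[OF b_hom]] by auto
    then show ?thesis using b_hom False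
    proof (induction n arbitrary: b i rule: less_induct)
      case (less n)
      note gb = g[OF less.prems(2)]
      have c_hom: "g b \<in> B (i + m)" by (rule g_hom[OF less.prems(2)])
      show ?case
      proof (cases "g b = 0")
        case True
        then have "(E ^^ 1) b = 0" using E_hom[OF less.prems(2)] by simp
        then show ?thesis ..
      next
        case False
        have "D (b ^ d) \<noteq> 0"
          unfolding gb[symmetric] by (intro no_zero_divisors nz_coeff[OF less.prems(3)] False)
        then have "n \<noteq> 0" using less.prems(1) deg_0_iff by metis
        then obtain n' where n': "n = Suc n'" using not0_implies_Suc by blast
        obtain e where e: "d = Suc e" using d_pos by (cases d) auto
        obtain n1 where n1: "deg n1 (g b ^ d)" using deg_exists[OF power_in_V[OF c_hom]] False by auto
        \<comment> \<open>The factors of \<open>D (b ^ d) = d b ^ (d - 1) g b\<close> need not lie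
          in \<open>V\<close>, so degrees are compared in the \<open>d\<close>-th power:
          \<open>d (n - 1) = (d - 1) n + n1\<close>, that is, \<open>n1 = n - d\<close>.\<close>
        have "deg 0 (of_nat (d ^ d))" using char_0[of "d ^ d"] d_pos by (simp only: deg_0_iff D_of_nat A_intros) simp
        then have "deg (0 + (e * n + n1)) (of_nat (d ^ d) * ((b ^ d) ^ e * g b ^ d))"
          by (intro deg_mult deg_power n1 less.prems(1))
        moreover have "of_nat (d ^ d) * ((b ^ d) ^ e * g b ^ d) = (of_nat d * b ^ (d - 1) * g b) ^ d"
          by (simp add: e power_mult_distrib flip: power_mult) (simp add: algebra_simps)
        ultimately have "deg (e * n + n1) (D (b ^ d) ^ d)" unfolding gb by simp
        moreover have "deg (d * n') (D (b ^ d) ^ d)"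
          by (rule deg_power, rule deg_D) (use less.prems(1) n' in simp)
        ultimately have "e * n + n1 = d * n'" by (rule deg_unique)
        then have "n1 < n" unfolding e n' by simp
        then obtain k where "(E ^^ k) (g b) = 0" using less.IH n1 c_hom False by blast
        then have "(E ^^ Suc k) b = 0" using E_hom[OF less.prems(2)] by (simp add: funpow_swap1)
        then show ?thesis ..
      qed
    qed
  qed (metis funpow_0)
  ultimately have "derivation_on UNIV E" "locally_nilpotent_on UNIV E"
    using locally_nilpotent_onI_homogeneous[of 1 E] unfolding veronese_1 by auto
  moreover have "\<forall>i b. b \<in> B i \<longrightarrow> E b \<in> B (i + m)" using E_hom g_hom by simp
  moreover have "\<exists>x. E x \<noteq> 0"
  proof -
    obtain x where x: "x \<in> V" "D x \<noteq> 0" using nz by blast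
    have "D x = (\<Sum>i\<in>supp x. D (cp x i))"
      using D_sum[of "supp x" "cp x"] cp_in_veronese[OF x(1)] by (simp add: sum_cp)
    then obtain i where i: "D (cp x i) \<noteq> 0" using x(2) sum.not_neutral_contains_not_neutral by metis
    have "D (cp x i ^ d) \<noteq> 0"
      using i D_0 char_0[OF d_pos] unfolding D_power[OF cp_in_veronese[OF x(1)]] by auto
    then have "g (cp x i) \<noteq> 0" using g[OF cp_in, of x i] by auto
    then show ?thesis using E_hom[OF cp_in] by metis
  qed
  ultimately show ?thesis by blast
qed

end

section \<open>Kernels of homogeneous locally nilpotent derivations\<close>

locale homogeneous_lnd = graded_domain B + lnd UNIV D
  for B :: "int \<Rightarrow> 'b::idom set" and D :: "'b \<Rightarrow> 'b" +
  fixes m :: int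
  assumes hom_D: "b \<in> B i \<Longrightarrow> D b \<in> B (i + m)"
    and nonzero: "\<exists>x. D x \<noteq> 0"
begin

definition K where "K = {x. D x = 0}"

lemma is_subring_K: "is_subring K"
  unfolding K_def by (subst is_subring_def) (auto simp: D_1 D_diff D_mult)

lemmas K_intros = subring_0[OF is_subring_K] subring_1[OF is_subring_K] subring_add[OF is_subring_K]
  subring_diff[OF is_subring_K] subring_mult[OF is_subring_K] subring_power[OF is_subring_K]
  subring_of_nat[OF is_subring_K]

lemmas polys_K = is_subring_polys_over[OF is_subring_K]
lemmas polys_K_intros = subring_0[OF polys_K] subring_1[OF polys_K] subring_add[OF polys_K]
  subring_diff[OF polys_K] subring_mult[OF polys_K] monom_in_polys_over[OF is_subring_K]
  const_in_polys_over[OF is_subring_K]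

lemma D_eq_sum: "D x = (\<Sum>i\<in>supp x. D (cp x i))"
  using D_sum[of "supp x" "cp x"] by (simp add: sum_cp)

text \<open>All degrees are shifted by the same \<open>m\<close>, so the components of
  \<open>D x\<close> are the images of those of \<open>x\<close>.\<close>

lemma cp_in_K:
  assumes "x \<in> K" shows "cp x i \<in> K"
proof -
  have "cp (D x) (i + m) = (\<Sum>j\<in>supp x. cp (D (cp x j)) (i + m))"
    by (subst D_eq_sum) (rule cp_sum)
  also have "\<dots> = (\<Sum>j\<in>supp x. if j = i then D (cp x i) else 0)"
    by (rule sum.cong) (auto simp: cp_hom[OF hom_D[OF cp_in]])
  also have "\<dots> = D (cp x i)" by (simp add: finite_supp D_0)
  finally show ?thesis using assms unfolding K_def by (simp add: cp_0)
qed

text \<open>Take a homogeneous \<open>b\<close> with \<open>D b \<noteq> 0\<close>; the iterate just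
  before its last nonzero one is such a \<open>t\<close>.\<close>

lemma homogeneous_slice: "\<exists>t \<tau>. t \<in> B \<tau> \<and> D t \<noteq> 0 \<and> D (D t) = 0"
proof -
  obtain x where "D x \<noteq> 0" using nonzero by blast
  then obtain i where "D (cp x i) \<noteq> 0"
    using D_eq_sum[of x] sum.not_neutral_contains_not_neutral by metis
  then obtain b where b: "b \<in> B i" "D b \<noteq> 0" using cp_in by blast
  have iter: "(D ^^ n) b \<in> B (i + int n * m)" for n
  proof (induction n)
    case (Suc n)
    then show ?case using hom_D[OF Suc] by (simp add: algebra_simps)
  qed (use b in simp)
  obtain n where n: "deg n b" using deg_exists[of b] b(2) D_0 by auto
  then obtain k where k: "n = Suc k" using b(2) by (cases n) (auto simp: deg_0_iff)
  show ?thesis using iter[of k] n unfolding k deg_def by auto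
qed

end

section \<open>The polynomial ring in a homogeneous local slice and its prime\<close>

locale sliced_lnd = homogeneous_lnd B D m
  for B :: "int \<Rightarrow> 'b::idom set" and D :: "'b \<Rightarrow> 'b" and m +
  fixes t :: 'b and \<tau> :: int
  assumes t_hom: "t \<in> B \<tau>" and Dt: "D t \<noteq> 0" and DDt: "D (D t) = 0"
begin

lemma Dt_K: "D t \<in> K" using DDt unfolding K_def by simp

lemma t_nz: "t \<noteq> 0" using Dt D_0 by auto

lemma iter_t_power: "(D ^^ n) (t ^ n) = of_nat (fact n) * D t ^ n \<and> (D ^^ Suc n) (t ^ n) = 0"
proof (induction n)
  case (Suc n)
  have "(D ^^ (1 + n)) (t * t ^ n) = of_nat ((1 + n) choose 1) * ((D ^^ 1) t * (D ^^ n) (t ^ n))"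
    by (rule iter_mult_top) (use Suc DDt in auto)
  then have eq: "(D ^^ Suc n) (t ^ Suc n) = of_nat (fact (Suc n)) * D t ^ Suc n"
    using Suc by (simp add: algebra_simps)
  have "of_nat (fact (Suc n)) * D t ^ Suc n \<in> K" by (intro K_intros Dt_K)
  then have "(D ^^ Suc (Suc n)) (t ^ Suc n) = 0"
    unfolding K_def using eq by (simp only: funpow.simps comp_apply mem_Collect_eq)
  then show ?case using eq by blast
qed (simp add: D_1)

text \<open>Applying \<open>D\<close> as often as the degree of \<open>c\<close> leaves only the
  leading coefficient times \<open>n! (D t) ^ n\<close>, which is nonzero.\<close>

lemma transcendental:
  assumes c: "c \<in> polys_over K" and "poly c t = 0" shows "c = 0"
proof (rule ccontr)
  assume "c \<noteq> 0"
  define n where "n = degree c"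
  have Dc: "D (coeff c i) = 0" for i using c unfolding polys_over_def K_def by simp
  have iter_sum: "(D ^^ n) (sum f I) = (\<Sum>i\<in>I. (D ^^ n) (f i))" for f :: "nat \<Rightarrow> 'b" and I
    by (induction I rule: infinite_finite_induct) (auto simp: iter_0 iter_add)
  have "(D ^^ n) (coeff c i * t ^ i) = (if i = n then lead_coeff c * (of_nat (fact n) * D t ^ n) else 0)"
    if "i \<le> n" for i
  proof (cases "i = n")
    case True
    then show ?thesis using iter_t_power[of n] iter_const_mult[OF _ Dc] by (simp add: n_def)
  next
    case False
    then have "(D ^^ n) (t ^ i) = 0"
      by (intro iter_zero_mono[OF conjunct2[OF iter_t_power]]) (use that in simp)
    then show ?thesis using False iter_const_mult[OF _ Dc] by simp
  qed
  then have "(D ^^ n) (poly c t) = (\<Sum>i\<le>n. if i = n then lead_coeff c * (of_nat (fact n) * D t ^ n) else 0)"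
    unfolding poly_altdef n_def[symmetric] iter_sum by (intro sum.cong) simp_all
  also have "\<dots> = lead_coeff c * (of_nat (fact n) * D t ^ n)" by simp
  also have "\<dots> \<noteq> 0" using \<open>c \<noteq> 0\<close> Dt char_0[of "fact n"] by simp
  finally show False using assms(2) iter_0 by simp
qed

lemma poly_eq_imp_eq:
  "c \<in> polys_over K \<Longrightarrow> c' \<in> polys_over K \<Longrightarrow> poly c t = poly c' t \<Longrightarrow> c = c'"
  using transcendental[of "c - c'"] by (simp add: polys_K_intros)

text \<open>The denominators are homogeneous so that the localization inherits the grading.\<close>

definition S where "S = {r. r \<in> K \<and> r \<noteq> 0 \<and> (\<exists>i. r \<in> B i)}"

lemma S_K: "r \<in> S \<Longrightarrow> r \<in> K" and S_nz: "r \<in> S \<Longrightarrow> r \<noteq> 0"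
  unfolding S_def by auto

lemma S_1: "1 \<in> S"
  unfolding S_def using hom_1 K_intros by auto

lemma S_mult: "r \<in> S \<Longrightarrow> s \<in> S \<Longrightarrow> r * s \<in> S"
  unfolding S_def using hom_mult K_intros(5) by fastforce

text \<open>Taylor expansion along \<open>t\<close>: subtract the leading term, which lowers the
  order of nilpotency, and recurse.\<close>

lemma clear_denominator: "\<exists>r\<in>S. \<exists>c\<in>polys_over K. r * b = poly c t"
proof -
  have "\<exists>r\<in>S. \<exists>c\<in>polys_over K. r * b = poly c t" if "(D ^^ n) b = 0" for n
    using that
  proof (induction n arbitrary: b)
    case 0
    then show ?case using S_1 polys_K_intros(1) by (metis funpow_0 mult_zero_right poly_0)
  next
    case (Suc n)
    define e where "e = (D ^^ n) b"
    \<comment> \<open>Equal to \<open>(D ^^ n) (t ^ n)\<close>, so that \<open>D ^^ n\<close> kills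
      \<open>r0 * b - e * t ^ n\<close>.\<close>
    define r0 where "r0 = of_nat (fact n) * D t ^ n"
    have e: "e \<in> K" using Suc.prems unfolding K_def e_def by simp
    have "r0 \<in> K" unfolding r0_def by (intro K_intros Dt_K)
    moreover have "r0 \<noteq> 0" unfolding r0_def using Dt char_0[of "fact n"] by simp
    moreover have "r0 \<in> B (int n * (\<tau> + m))"
      unfolding r0_def by (intro hom_of_nat_mult hom_power hom_D t_hom)
    ultimately have r0: "r0 \<in> S" unfolding S_def by blast
    have "(D ^^ n) (r0 * b - e * t ^ n) = r0 * e - e * r0"
      using iter_const_mult[of r0 b n] iter_const_mult[of e "t ^ n" n] S_K[OF r0] e iter_t_power[of n]
      by (simp add: iter_diff K_def e_def[symmetric] r0_def[symmetric])
    then have "(D ^^ n) (r0 * b - e * t ^ n) = 0" by simp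
    then obtain r c where rc: "r \<in> S" "c \<in> polys_over K" "r * (r0 * b - e * t ^ n) = poly c t"
      using Suc.IH by blast
    have "(r * r0) * b = poly (c + monom (r * e) n) t"
      using rc(3) by (simp add: poly_monom algebra_simps)
    moreover have "c + monom (r * e) n \<in> polys_over K"
      by (intro polys_K_intros K_intros rc(2) e S_K[OF rc(1)])
    ultimately show ?case using S_mult[OF rc(1) r0] by blast
  qed
  then show ?thesis using nilpotent unfolding locally_nilpotent_on_def by blast
qed

text \<open>The contraction to \<open>B\<close> of the ideal generated by \<open>t\<close> in the localization \<open>S\<inverse>B = (S\<inverse>K)[t]\<close>.\<close>

definition P where
  "P = {b. \<exists>r\<in>S. \<exists>c\<in>polys_over K. r * b = t * poly c t}"

text \<open>Two representations of \<open>b\<close> with cleared denominators agree after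
  cross-multiplication, as \<open>t\<close> is transcendental over \<open>K\<close>; so any one of
  them decides membership.\<close>

lemma in_P_iff:
  assumes "r \<in> S" "c \<in> polys_over K" "r * b = poly c t"
  shows "b \<in> P \<longleftrightarrow> coeff c 0 = 0"
proof
  assume "b \<in> P"
  then obtain s e where s: "s \<in> S" "e \<in> polys_over K" "s * b = t * poly e t" unfolding P_def by blast
  have "poly (smult s c) t = s * (r * b)" using assms(3) by simp
  also have "\<dots> = poly (smult r (pCons 0 e)) t" using s(3) by (simp add: mult.left_commute[of s])
  finally have "[:s:] * c = [:r:] * (pCons 0 e)"
    by (intro poly_eq_imp_eq polys_K_intros const_in_polys_over[OF is_subring_K] pCons_in_polys_over K_intros S_K s assms) simp
  then have "coeff ([:s:] * c) 0 = coeff ([:r:] * pCons 0 e) 0" by simp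
  then show "coeff c 0 = 0" using S_nz[OF s(1)] by simp
next
  assume "coeff c 0 = 0"
  obtain a e where c: "c = pCons a e" by (rule pCons_cases)
  have "coeff e i \<in> K" for i using assms(2) unfolding polys_over_def c by (metis (mono_tags) coeff_pCons_Suc mem_Collect_eq)
  then have "e \<in> polys_over K" unfolding polys_over_def by simp
  moreover have "r * b = t * poly e t" using assms(3) \<open>coeff c 0 = 0\<close> unfolding c by simp
  ultimately show "b \<in> P" unfolding P_def using assms(1) by blast
qed

lemma K_not_in_P: "x \<in> K \<Longrightarrow> x \<noteq> 0 \<Longrightarrow> x \<notin> P"
  using in_P_iff[of 1 "[:x:]" x] S_1 polys_K_intros(7) by simp

lemma t_in_P: "t \<in> P"
  unfolding P_def using S_1 polys_K_intros(2) by (intro CollectI bexI[of _ 1]) auto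

text \<open>\<open>P\<close> is the kernel of the ring homomorphism to the localization of the
  domain \<open>K\<close> that sends \<open>t\<close> to 0; the proof computes with constant
  coefficients.\<close>

lemma prime_P: "is_prime_ideal P"
  unfolding is_prime_ideal_def
proof (intro conjI allI impI)
  show "P \<noteq> UNIV" using K_not_in_P[of 1] K_intros(2) by auto
  show "is_ideal P"
    unfolding is_ideal_def
  proof (intro conjI allI ballI)
    show "0 \<in> P" using in_P_iff[of 1 0 0] S_1 polys_K_intros(1) by simp
    fix x assume x: "x \<in> P"
    obtain r c where rc: "r \<in> S" "c \<in> polys_over K" "r * x = poly c t" using clear_denominator by blast
    have c0: "coeff c 0 = 0" using in_P_iff rc x by blast
    {
      fix y assume y: "y \<in> P"
      obtain s e where se: "s \<in> S" "e \<in> polys_over K" "s * y = poly e t" using clear_denominator by blast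
      have "(r * s) * (x + y) = s * (r * x) + r * (s * y)" by (simp only: algebra_simps)
      also have "\<dots> = poly ([:s:] * c + [:r:] * e) t" using rc se by simp
      finally have eq: "(r * s) * (x + y) = poly ([:s:] * c + [:r:] * e) t" .
      have "coeff e 0 = 0" using in_P_iff se y by blast
      then have "coeff ([:s:] * c + [:r:] * e) 0 = 0" using c0 by simp
      then show "x + y \<in> P"
        using in_P_iff[OF S_mult[OF rc(1) se(1)] _ eq] rc se S_K
        by (simp only: polys_K_intros)
    next
      fix y
      obtain s e where se: "s \<in> S" "e \<in> polys_over K" "s * y = poly e t" using clear_denominator by blast
      have "(s * r) * (y * x) = (s * y) * (r * x)" by (simp only: ac_simps)
      also have "\<dots> = poly (e * c) t" using rc se by simp
      finally have eq: "(s * r) * (y * x) = poly (e * c) t" .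
      show "y * x \<in> P"
        using in_P_iff[OF S_mult[OF se(1) rc(1)] _ eq] rc se c0
        by (simp add: polys_K_intros coeff_mult)
    }
  qed
  fix x y assume xy: "x * y \<in> P"
  obtain r c where rc: "r \<in> S" "c \<in> polys_over K" "r * x = poly c t" using clear_denominator by blast
  obtain s e where se: "s \<in> S" "e \<in> polys_over K" "s * y = poly e t" using clear_denominator by blast
  have "(r * s) * (x * y) = (r * x) * (s * y)" by (simp only: ac_simps)
  also have "\<dots> = poly (c * e) t" using rc se by simp
  finally have "coeff (c * e) 0 = 0"
    using in_P_iff[OF S_mult[OF rc(1) se(1)] _, of "c * e" "x * y"] rc se xy by (simp add: polys_K_intros)
  then have "coeff c 0 = 0 \<or> coeff e 0 = 0" by (simp add: coeff_mult)
  then show "x \<in> P \<or> y \<in> P" using in_P_iff rc se by blast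
qed

text \<open>Since \<open>t ^ i\<close> has degree \<open>i \<tau>\<close>, the component of degree
  \<open>k\<close> picks from each coefficient the part of degree
  \<open>k - i \<tau>\<close>.\<close>

lemma cp_poly:
  assumes c: "c \<in> polys_over K"
  shows "\<exists>c'\<in>polys_over K. cp (poly c t) k = poly c' t \<and> coeff c' 0 = cp (coeff c 0) k"
proof -
  define c' where "c' = (\<Sum>i\<le>degree c. monom (cp (coeff c i) (k - int i * \<tau>)) i)"
  have "c' \<in> polys_over K"
    unfolding c'_def using c
    by (intro subring_sum[OF polys_K] monom_in_polys_over[OF is_subring_K] cp_in_K) (simp add: polys_over_def)
  moreover have "cp (poly c t) k = poly c' t"
    unfolding poly_altdef[of c] c'_def
    by (simp add: cp_sum poly_sum poly_monom mult.commute[of "coeff c _"] mult.commute[of _ "t ^ _"] cp_hom_mult[OF hom_power[OF t_hom]])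
  moreover have "coeff c' 0 = cp (coeff c 0) k"
    unfolding c'_def coeff_sum by (simp add: coeff_monom)
  ultimately show ?thesis by blast
qed

lemma cp_in_P:
  assumes "b \<in> P" shows "cp b i \<in> P"
proof -
  obtain r c where rc: "r \<in> S" "c \<in> polys_over K" "r * b = poly c t" using clear_denominator by blast
  then have c0: "coeff c 0 = 0" using in_P_iff assms by blast
  obtain \<rho> where \<rho>: "r \<in> B \<rho>" using rc(1) unfolding S_def by blast
  obtain c' where c': "c' \<in> polys_over K" "cp (poly c t) (i + \<rho>) = poly c' t" "coeff c' 0 = cp (coeff c 0) (i + \<rho>)"
    using cp_poly[OF rc(2)] by blast
  have "r * cp b i = poly c' t"
    using cp_hom_mult[OF \<rho>, of b "i + \<rho>"] unfolding rc(3) c'(2) by simp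
  then show ?thesis using in_P_iff[OF rc(1) c'(1)] c'(3) c0 by (simp add: cp_0)
qed

text \<open>For nonzero \<open>x\<close> in \<open>Q\<close>, clear denominators and split off the
  power of \<open>t\<close>: the cofactor has nonzero constant coefficient, hence is outside
  \<open>P\<close>. So \<open>t\<close> is in \<open>Q\<close>, and as \<open>S\<close> misses
  \<open>P\<close>, all of \<open>P\<close> is.\<close>

lemma height_P: "ideal_height P = 1"
proof (rule ideal_height_eq_1[OF prime_P])
  show "P \<noteq> {0}" using t_in_P t_nz by blast
  fix Q assume Q: "is_prime_ideal Q" "Q \<subset> P"
  have Q_mult: "r * x \<in> Q" if "x \<in> Q" for r x using Q(1) that unfolding is_prime_ideal_def is_ideal_def by blast
  have Q_prime: "x \<in> Q \<or> y \<in> Q" if "x * y \<in> Q" for x y using Q(1) that unfolding is_prime_ideal_def by blast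
  have "1 \<notin> Q" using K_not_in_P[of 1] K_intros(2) Q(2) by auto
  have "x = 0" if x: "x \<in> Q" for x
  proof (rule ccontr)
    assume "x \<noteq> 0"
    obtain r c where rc: "r \<in> S" "c \<in> polys_over K" "r * x = poly c t" using clear_denominator by blast
    have "c \<noteq> 0" using rc(3) S_nz[OF rc(1)] \<open>x \<noteq> 0\<close> by auto
    then have "\<exists>n. coeff c n \<noteq> 0" using leading_coeff_0_iff by blast
    then obtain n where n: "coeff c n \<noteq> 0" "\<And>i. i < n \<Longrightarrow> coeff c i = 0"
      using exists_least_iff[of "\<lambda>n. coeff c n \<noteq> 0"] by blast
    define e where "e = poly_shift n c"
    have "c = monom 1 n * e"
      unfolding e_def by (rule poly_eqI) (auto simp: coeff_monom_mult coeff_poly_shift n(2))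
    then have "poly c t = t ^ n * poly e t" by (simp add: poly_monom)
    then have "t ^ n * poly e t \<in> Q" using Q_mult[OF x, of r] rc(3) by simp
    moreover have "e \<in> polys_over K" using rc(2) unfolding e_def polys_over_def by (simp add: coeff_poly_shift)
    then have "poly e t \<notin> P"
      using in_P_iff[of 1 e "poly e t"] S_1 n(1) unfolding e_def by (simp add: coeff_poly_shift)
    ultimately have "t ^ n \<in> Q" using Q_prime Q(2) by blast
    moreover have "t ^ k \<in> Q \<Longrightarrow> t \<in> Q" for k
      using Q_prime \<open>1 \<notin> Q\<close> by (induction k) auto
    ultimately have tQ: "t \<in> Q" by blast
    have "P \<subseteq> Q"
    proof
      fix b assume "b \<in> P"
      then obtain r c where rc: "r \<in> S" "r * b = t * poly c t" unfolding P_def by blast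
      then have "r * b \<in> Q" using Q_mult[OF tQ, of "poly c t"] by (simp add: mult.commute)
      moreover have "r \<notin> Q" using K_not_in_P S_K[OF rc(1)] S_nz[OF rc(1)] Q(2) by blast
      ultimately show "b \<in> Q" using Q_prime by blast
    qed
    then show False using Q(2) by blast
  qed
  then show "Q = {0}" using Q(1) unfolding is_prime_ideal_def is_ideal_def by blast
qed

lemma P_height_one: "P \<in> height_one_homogeneous_primes B"
  using prime_P height_P homogeneous_idealI[OF _ cp_in_P]
  unfolding height_one_homogeneous_primes_def is_prime_ideal_def by blast

text \<open>Degrees of \<open>B\<close> outside \<open>P\<close> are differences of degrees of
  \<open>K\<close>, so \<open>Gcd T\<close> divides \<open>e_quotient B P\<close> and, by
  saturation, \<open>e_ring B\<close>.\<close>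

lemma exists_kernel_residue:
  assumes sat: "saturated_in_codim_1 B" and "d > 0"
  shows "\<exists>h j. h \<in> B j \<and> h \<noteq> 0 \<and> D h = 0 \<and> int d dvd j + m"
proof -
  define T where "T = {i. \<exists>h\<in>B i. h \<noteq> 0 \<and> h \<in> K}"
  have T_0: "0 \<in> T" unfolding T_def using hom_1 K_intros(2) by (intro CollectI bexI[of _ 1]) simp_all
  have T_add: "i + j \<in> T" if ij: "i \<in> T" "j \<in> T" for i j
  proof -
    obtain x y where "x \<in> B i" "x \<noteq> 0" "x \<in> K" "y \<in> B j" "y \<noteq> 0" "y \<in> K"
      using ij unfolding T_def by blast
    then have "x * y \<in> B (i + j)" "x * y \<noteq> 0" "x * y \<in> K" using hom_mult K_intros(5) by simp_all
    then show ?thesis unfolding T_def by blast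
  qed
  have "Gcd T dvd n" if b: "b \<in> B n" "b \<notin> P" for b n
  proof -
    obtain r c where rc: "r \<in> S" "c \<in> polys_over K" "r * b = poly c t" using clear_denominator by blast
    obtain \<rho> where \<rho>: "r \<in> B \<rho>" using rc(1) unfolding S_def by blast
    \<comment> \<open>Passing to the component of degree \<open>\<rho> + n\<close> makes the
      constant coefficient homogeneous; it is nonzero because \<open>b\<close> is outside
      \<open>P\<close>.\<close>
    obtain c' where c': "c' \<in> polys_over K" "cp (poly c t) (\<rho> + n) = poly c' t" "coeff c' 0 = cp (coeff c 0) (\<rho> + n)"
      using cp_poly[OF rc(2)] by blast
    have "r * b = poly c' t"
      using cp_hom[OF hom_mult[OF \<rho> b(1)], of "\<rho> + n"] unfolding rc(3) c'(2) by simp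
    then have "coeff c' 0 \<noteq> 0" using in_P_iff[OF rc(1) c'(1)] b(2) by blast
    moreover have "coeff c' 0 \<in> K" using c'(1) unfolding polys_over_def by blast
    ultimately have "\<rho> + n \<in> T" unfolding T_def c'(3) by (intro CollectI bexI[OF _ cp_in]) simp
    moreover have "\<rho> \<in> T" unfolding T_def using \<rho> S_K[OF rc(1)] S_nz[OF rc(1)] by blast
    ultimately have "Gcd T dvd (\<rho> + n) - \<rho>" by (intro dvd_diff Gcd_dvd)
    then show ?thesis by simp
  qed
  then have "Gcd T dvd e_quotient B P"
    using prime_P e_quotient_eq[of P] unfolding is_prime_ideal_def by (auto intro!: Gcd_greatest)
  then have "Gcd T dvd e_ring B" using e_quotient_dvd[OF sat P_height_one] dvd_trans by blast
  \<comment> \<open>\<open>m\<close> is the difference of the degrees of \<open>D t\<close> and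
    \<open>t\<close>.\<close>
  then have "Gcd T dvd \<tau>" "Gcd T dvd \<tau> + m"
    using e_ring_dvd[OF t_hom t_nz] e_ring_dvd[OF hom_D[OF t_hom] Dt] dvd_trans by blast+
  then have "Gcd T dvd m" by (simp add: dvd_add_right_iff)
  then have "\<exists>j\<in>T. int d dvd j + m" using semigroup_residues[OF T_0 T_add _ \<open>d > 0\<close>] by blast
  then show ?thesis unfolding T_def K_def by blast
qed

end

lemma (in homogeneous_lnd) veronese_not_rigid:
  assumes sat: "saturated_in_codim_1 B" and d: "d > 0"
  shows "\<not> rigid (veronese d B)"
proof -
  obtain t \<tau> where t: "t \<in> B \<tau>" "D t \<noteq> 0" "D (D t) = 0" using homogeneous_slice by blast
  interpret sliced_lnd B D m t \<tau> by unfold_locales (use t in auto)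
  obtain h j where h: "h \<in> B j" "h \<noteq> 0" "D h = 0" "int d dvd j + m"
    using exists_kernel_residue[OF sat d] by blast
  define E where "E x = h * D x" for x
  have "E x \<in> veronese d B" if x: "x \<in> veronese d B" for x
  proof -
    have "E x = (\<Sum>i\<in>supp x. h * D (cp x i))"
      unfolding E_def by (subst D_eq_sum) (simp add: sum_distrib_left)
    moreover have "h * D (cp x i) \<in> veronese d B" if i: "i \<in> supp x" for i
    proof (rule hom_in_veronese[OF hom_mult[OF h(1) hom_D[OF cp_in]]])
      have "int d dvd i" using x i unfolding veronese_iff by blast
      then have "int d dvd (j + m) + i" using h(4) by (rule dvd_add[rotated])
      then show "int d dvd j + (i + m)" by (simp add: algebra_simps)
    qed
    ultimately show ?thesis using subring_sum[OF is_subring_veronese] by metis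
  qed
  then have "derivation_on (veronese d B) E"
    unfolding derivation_on_def E_def by (auto simp: D_add D_mult algebra_simps)
  \<comment> \<open>\<open>h\<close> is a kernel element, so its powers pass through
    \<open>D\<close>.\<close>
  moreover have "(E ^^ n) x = h ^ n * (D ^^ n) x" for n x
  proof (induction n)
    case (Suc n)
    have "D (h ^ n) = 0" using D_power[of h n] h(3) by simp
    then show ?case unfolding E_def[abs_def] using Suc by (simp add: E_def D_mult algebra_simps)
  qed simp
  then have "locally_nilpotent_on (veronese d B) E"
    using nilpotent unfolding locally_nilpotent_on_def by (metis UNIV_I mult_zero_right)
  moreover have "t ^ d \<in> veronese d B" by (rule hom_in_veronese[OF hom_power[OF t(1)]]) simp
  moreover have "E (t ^ d) \<noteq> 0"
    using h(2) t(2) t_nz char_0[OF d] by (simp add: E_def D_power)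
  ultimately show ?thesis unfolding rigid_def by blast
qed

theorem corollary7p17:
  fixes \<iota> :: "'k::field_char_0 \<Rightarrow> 'b::idom"
    and B :: "int \<Rightarrow> 'b set"
  assumes "affine_algebra \<iota>"
    and "normal_domain TYPE('b)"
    and "is_grading B"
    and "saturated_in_codim_1 B"
  shows "NR B = {} \<or> NR B = UNIV - {0}"
proof (cases "NR B = {}")
  case False
  then obtain d where d: "d > 0" "\<not> rigid (veronese d B)" unfolding NR_def by blast
  then obtain D where D: "derivation_on (veronese d B) D" "locally_nilpotent_on (veronese d B) D"
      "\<exists>x\<in>veronese d B. D x \<noteq> 0"
    unfolding rigid_def by blast
  have \<iota>: "algebra_map \<iota>" using assms(1) unfolding affine_algebra_def by blast
  \<comment> \<open>Positive integers are invertible in the field, hence in \<open>B\<close>; this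
    also gives characteristic 0.\<close>
  have unit: "of_nat n * \<iota> (inverse (of_nat n)) = 1" if "n > 0" for n
    using algebra_map_inverse[OF \<iota>, of "of_nat n"] that by (simp add: algebra_map_of_nat[OF \<iota>])
  then have char_0: "of_nat n \<noteq> (0 :: 'b)" if "n > 0" for n
    using that by (metis mult_zero_left zero_neq_one)
  interpret graded_domain B using assms(3) by unfold_locales
  interpret V: veronese_lnd B d D
    using D d(1) char_0 is_subring_veronese by unfold_locales auto
  obtain E m where E: "derivation_on (veronese d B) E" "locally_nilpotent_on (veronese d B) E"
      "\<exists>x\<in>veronese d B. E x \<noteq> 0" "\<And>i b. int d dvd i \<Longrightarrow> b \<in> B i \<Longrightarrow> E b \<in> B (i + m)"
    using V.homogeneous_lnd_exists[OF assms(1) D(3)] by blast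
  interpret E: veronese_lnd B d E
    using E d(1) char_0 is_subring_veronese by unfold_locales auto
  have "\<exists>c. of_nat d * c = (1 :: 'b)" using unit[OF d(1)] by blast
  then obtain F where F: "derivation_on UNIV F" "locally_nilpotent_on UNIV F" "\<exists>x. F x \<noteq> 0"
      "\<And>i b. b \<in> B i \<Longrightarrow> F b \<in> B (i + m)"
    using E.extension[OF affine_algebra_noetherian[OF assms(1)] assms(2,4) _ E(3,4)] by blast
  \<comment> \<open>\<open>F\<close> is a homogeneous derivation of all of \<open>B\<close>, no
    longer tied to the given \<open>d\<close>, so every Veronese subring is covered.\<close>
  interpret F: homogeneous_lnd B F m
    using F char_0 by unfold_locales (auto simp: is_subring_def)
  have "NR B = UNIV - {0}"
    unfolding NR_def using F.veronese_not_rigid[OF assms(4)] by auto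
  then show ?thesis ..
qed simp

end
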